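(* The integer group determinants of $GA(1,9)$ are exactly the integers of the form $$D=AB^{8},\qquad A,B\in\mathbb Z,$$ where either $A$ is odd or $2^5\mid A$, and $B\equiv A\pmod 9$.
   Context: For a finite group $G=\{g_1,\dots,g_n\}$ and an element $\sum_{g\in G}a_g g$ of the group ring $\mathbb Z[G]$ (all $a_g\in\mathbb Z$), the group determinant is $D\left(\sum_{g\in G}a_g g\right)=\det\left(a_{g_ig_j^{-1}}\right)_{i,j=1}^n$. An integer group determinant of $G$ is any integer of this form. The general affine group of degree one over $\mathbb F_9$ is $GA(1,9)=\left\{\begin{pmatrix} a & b\\ 0 & 1\end{pmatrix}: a\in\mathbb F_9^*,\ b\in\mathbb F_9\right\}$ under matrix multiplication (a group of order $72$). *)

theory Defs
  imports "Jordan_Normal_Form.Determinant" "HOL-Number_Theory.Cong"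
begin

text \<open>A finite group is given by its carrier set G, multiplication gmult and
inversion ginv.  The group matrix (a_{g_i g_j^{-1}}) is formed with respect to an
(arbitrary) enumeration g_1,...,g_n of G without repetitions; the determinant does
not depend on the chosen enumeration.\<close>

definition group_enum :: "'g set \<Rightarrow> 'g list" where
  "group_enum G = (SOME gs. distinct gs \<and> set gs = G)"

definition group_det ::
  "'g set \<Rightarrow> ('g \<Rightarrow> 'g \<Rightarrow> 'g) \<Rightarrow> ('g \<Rightarrow> 'g) \<Rightarrow> ('g \<Rightarrow> int) \<Rightarrow> int" where
  "group_det G gmult ginv a =
     (let gs = group_enum G; n = length gs
      in det (mat n n (\<lambda>(i, j). a (gmult (gs ! i) (ginv (gs ! j))))))"

definition int_group_dets ::
  "'g set \<Rightarrow> ('g \<Rightarrow> 'g \<Rightarrow> 'g) \<Rightarrow> ('g \<Rightarrow> 'g) \<Rightarrow> int set" where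
  "int_group_dets G gmult ginv = {group_det G gmult ginv a | a. True}"

section \<open>The field F_9 = F_3[i], i^2 = -1\<close>

text \<open>An element x + y i of F_9 is represented by the pair (x, y) with
x, y in {0,1,2}.\<close>

type_synonym f9 = "int \<times> int"

definition F9 :: "f9 set" where
  "F9 = {0..2} \<times> {0..2}"

definition f9_add :: "f9 \<Rightarrow> f9 \<Rightarrow> f9" where
  "f9_add u v = ((fst u + fst v) mod 3, (snd u + snd v) mod 3)"

definition f9_mult :: "f9 \<Rightarrow> f9 \<Rightarrow> f9" where
  "f9_mult u v = ((fst u * fst v - snd u * snd v) mod 3,
                  (fst u * snd v + snd u * fst v) mod 3)"

text \<open>The matrix [[a, b], [0, 1]] is represented by the pair (a, b);
matrix multiplication gives (a, b)(c, d) = (ac, ad + b).\<close>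

definition GA19 :: "(f9 \<times> f9) set" where
  "GA19 = (F9 - {(0, 0)}) \<times> F9"

definition ga_mult :: "f9 \<times> f9 \<Rightarrow> f9 \<times> f9 \<Rightarrow> f9 \<times> f9" where
  "ga_mult g h = (f9_mult (fst g) (fst h), f9_add (f9_mult (fst g) (snd h)) (snd g))"

definition ga_one :: "f9 \<times> f9" where
  "ga_one = ((1, 0), (0, 0))"

definition ga_inv :: "f9 \<times> f9 \<Rightarrow> f9 \<times> f9" where
  "ga_inv g = (THE h. h \<in> GA19 \<and> ga_mult g h = ga_one)"

end

theory Submission
  imports Defs Complex_Main
begin

text \<open>Left multiplication on \<open>\<rat>[G] = \<rat>[C\<^sub>8] \<times> M\<^sub>8(\<rat>)\<close> gives \<open>D = A B\<^sup>8\<close>, where \<open>A\<close> is the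
  circulant determinant of the image in \<open>\<int>[C\<^sub>8]\<close> and \<open>B\<close> the determinant on the augmentation
  sublattice of \<open>\<int>[F9]\<close>.  The parity condition is a property of circulants of order \<open>8\<close>, read off
  from their factorization over the eighth roots of unity.

  For \<open>B = A\<close> modulo \<open>9\<close>, pass to the Galois ring \<open>\<int>[i] / 9\<close>, which contains the Teichmueller
  characters of \<open>F9\<close>.  In the basis of these characters the matrix of \<open>B\<close> has the character values of
  \<open>A\<close> on the diagonal, and its other entries are multiples of Jacobi sums, whose divisibility by \<open>3\<close>
  is a number of base \<open>3\<close> carries (Stickelberger).  The carries along any permutation other
  than the identity add up to at least \<open>2\<close>, so modulo \<open>9\<close> only the diagonal contributes.

  For the converse, add to a fixed element the terms \<open>j s\<close> and \<open>k (1 - n) s\<close>, where \<open>s\<close> is the sum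
  of the subgroup \<open>C\<^sub>8\<close> and \<open>n\<close> a translation.  Both are rank one perturbations, so \<open>A\<close> is affine in
  \<open>j\<close> and \<open>B\<close> is affine in \<open>j\<close> and \<open>k\<close>.\<close>

section \<open>Determinants indexed by lists\<close>

text \<open>Indexing by the objects themselves lets matrix products be written as sums over sets of
  field elements, exponents or block indices.\<close>

definition sdet :: "'i list \<Rightarrow> ('i \<Rightarrow> 'i \<Rightarrow> 'a::comm_ring_1) \<Rightarrow> 'a" where
  "sdet xs f = det (mat (length xs) (length xs) (\<lambda>(i, j). f (xs ! i) (xs ! j)))"

lemma sum_nth_distinct:
  assumes "distinct xs"
  shows "(\<Sum>i = 0..<length xs. f (xs ! i)) = sum f (set xs)"
  using bij_betw_nth[OF assms refl refl] 
  by (simp add: sum.reindex_bij_betw atLeast0LessThan)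

lemma prod_nth_distinct:
  assumes "distinct xs"
  shows "(\<Prod>i = 0..<length xs. f (xs ! i)) = prod f (set xs)"
  using bij_betw_nth[OF assms refl refl] 
  by (simp add: prod.reindex_bij_betw atLeast0LessThan)

lemma sdet_cong:
  assumes "\<And>x y. x \<in> set xs \<Longrightarrow> y \<in> set xs \<Longrightarrow> f x y = g x y"
  shows "sdet xs f = sdet xs g"
  unfolding sdet_def by (rule arg_cong[where f = det], rule cong_mat) (auto simp: assms)

lemma sdet_map: "sdet (map h xs) f = sdet xs (\<lambda>i j. f (h i) (h j))"
  unfolding sdet_def by (rule arg_cong[where f = det], rule eq_matI) auto

lemma of_int_sdet: "of_int (sdet xs f) = sdet xs (\<lambda>i j. of_int (f i j))"
proof -
  have "map_mat of_int (mat (length xs) (length xs) (\<lambda>(i, j). f (xs ! i) (xs ! j)))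
      = mat (length xs) (length xs) (\<lambda>(i, j). of_int (f (xs ! i) (xs ! j)))"
    by (rule eq_matI) auto
  then show ?thesis
    unfolding sdet_def by (metis of_int_hom.hom_det)
qed

text \<open>If \<open>W X = Y W\<close> and \<open>V W = d I\<close>, then \<open>det V det W = d ^ n\<close> cancels out of
  \<open>det W det X = det Y det W\<close> up to the factor \<open>d ^ n\<close>.\<close>
lemma sdet_intertwine:
  fixes X :: "'i \<Rightarrow> 'i \<Rightarrow> 'a::comm_ring_1" and Y :: "'j \<Rightarrow> 'j \<Rightarrow> 'a"
  assumes xs: "distinct xs" and ys: "distinct ys" and len: "length ys = length xs"
    and WX: "\<And>t s. t \<in> set ys \<Longrightarrow> s \<in> set xs \<Longrightarrow>
        (\<Sum>s'\<in>set xs. W t s' * X s' s) = (\<Sum>t'\<in>set ys. Y t t' * W t' s)"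
    and VW: "\<And>s s'. s \<in> set xs \<Longrightarrow> s' \<in> set xs \<Longrightarrow>
        (\<Sum>t\<in>set ys. V s t * W t s') = (if s = s' then d else 0)"
  shows "d ^ length xs * sdet xs X = d ^ length xs * sdet ys Y"
proof -
  define n where "n = length xs"
  define Wm where "Wm = mat n n (\<lambda>(i, j). W (ys ! i) (xs ! j))"
  define Vm where "Vm = mat n n (\<lambda>(i, j). V (xs ! i) (ys ! j))"
  define Xm where "Xm = mat n n (\<lambda>(i, j). X (xs ! i) (xs ! j))"
  define Ym where "Ym = mat n n (\<lambda>(i, j). Y (ys ! i) (ys ! j))"
  note defs = Wm_def Vm_def Xm_def Ym_def
  have carr: "Wm \<in> carrier_mat n n" "Vm \<in> carrier_mat n n"
      "Xm \<in> carrier_mat n n" "Ym \<in> carrier_mat n n"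
    by (auto simp: defs)
  have sx: "(\<Sum>i = 0..<n. f (xs ! i)) = sum f (set xs)" for f :: "'i \<Rightarrow> 'a"
    unfolding n_def by (rule sum_nth_distinct[OF xs])
  have sy: "(\<Sum>i = 0..<n. f (ys ! i)) = sum f (set ys)" for f :: "'j \<Rightarrow> 'a"
    unfolding n_def len[symmetric] by (rule sum_nth_distinct[OF ys])
  have "Wm * Xm = Ym * Wm"
  proof (rule eq_matI)
    fix i j assume "i < dim_row (Ym * Wm)" "j < dim_col (Ym * Wm)"
    then have ij: "i < n" "j < n" by (auto simp: defs)
    then have "ys ! i \<in> set ys" "xs ! j \<in> set xs"
      using len by (auto simp: n_def)
    from WX[OF this] show "(Wm * Xm) $$ (i, j) = (Ym * Wm) $$ (i, j)"
      using ij by (simp add: defs scalar_prod_def flip: sx sy)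
  qed (auto simp: defs)
  then have 1: "det Wm * det Xm = det Ym * det Wm"
    using carr by (metis det_mult)
  have "Vm * Wm = d \<cdot>\<^sub>m 1\<^sub>m n"
  proof (rule eq_matI)
    fix i j assume "i < dim_row (d \<cdot>\<^sub>m 1\<^sub>m n)" "j < dim_col (d \<cdot>\<^sub>m 1\<^sub>m n :: 'a mat)"
    then have ij: "i < n" "j < n" by auto
    then have "xs ! i \<in> set xs" "xs ! j \<in> set xs"
      by (auto simp: n_def)
    from VW[OF this] show "(Vm * Wm) $$ (i, j) = (d \<cdot>\<^sub>m 1\<^sub>m n) $$ (i, j)"
      using ij xs by (simp add: defs scalar_prod_def n_def nth_eq_iff_index_eq flip: sy[unfolded n_def])
  qed (auto simp: defs)
  then have 2: "det Vm * det Wm = d ^ n"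
    using carr by (simp flip: det_mult)
  have "d ^ n * det Xm = det Vm * (det Wm * det Xm)"
    by (simp add: 2[symmetric] mult.assoc)
  also have "\<dots> = d ^ n * det Ym"
    unfolding 1 2[symmetric] by (simp add: mult_ac)
  finally show ?thesis
    by (simp add: sdet_def defs n_def len)
qed

lemma sdet_diag:
  assumes "distinct xs"
    and "\<And>x y. x \<in> set xs \<Longrightarrow> y \<in> set xs \<Longrightarrow> x \<noteq> y \<Longrightarrow> f x y = 0"
  shows "sdet xs f = (\<Prod>x\<in>set xs. f x x)"
proof -
  let ?A = "mat (length xs) (length xs) (\<lambda>(i, j). f (xs ! i) (xs ! j))"
  have "upper_triangular ?A"
    using assms by (auto simp: upper_triangular_def nth_eq_iff_index_eq)
  then have "det ?A = prod_list (diag_mat ?A)"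
    by (intro det_upper_triangular) auto
  also have "\<dots> = (\<Prod>i = 0..<length xs. f (xs ! i) (xs ! i))"
    by (simp add: prod_list_diag_prod)
  finally show ?thesis
    by (simp add: sdet_def prod_nth_distinct[OF assms(1), of "\<lambda>x. f x x"])
qed

lemma sdet_append:
  fixes f :: "'i \<Rightarrow> 'i \<Rightarrow> 'a::idom"
  assumes "\<And>x y. x \<in> set xs \<Longrightarrow> y \<in> set ys \<Longrightarrow> f y x = 0"
  shows "sdet (xs @ ys) f = sdet xs f * sdet ys f"
proof -
  let ?m = "length xs" and ?n = "length ys"
  let ?A = "mat ?m ?m (\<lambda>(i, j). f (xs ! i) (xs ! j))"
  let ?B = "mat ?m ?n (\<lambda>(i, j). f (xs ! i) (ys ! j))"
  let ?D = "mat ?n ?n (\<lambda>(i, j). f (ys ! i) (ys ! j))"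
  have "mat (?m + ?n) (?m + ?n) (\<lambda>(i, j). f ((xs @ ys) ! i) ((xs @ ys) ! j))
      = four_block_mat ?A ?B (0\<^sub>m ?n ?m) ?D"
    by (rule eq_matI) (auto simp: nth_append assms)
  then show ?thesis
    by (simp add: sdet_def det_four_block_mat_lower_left_zero[OF _ _ refl])
qed

lemma sdet_concat:
  fixes f :: "'i \<Rightarrow> 'i \<Rightarrow> 'a::idom"
  assumes "distinct js"
    and "\<And>i j x y. i \<in> set js \<Longrightarrow> j \<in> set js \<Longrightarrow> i \<noteq> j \<Longrightarrow> x \<in> set (g i) \<Longrightarrow> y \<in> set (g j) \<Longrightarrow> f x y = 0"
  shows "sdet (concat (map g js)) f = (\<Prod>j\<in>set js. sdet (g j) f)"
  using assms
proof (induction js)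
  case Nil
  then show ?case by (simp add: sdet_def)
next
  case (Cons j js)
  have "sdet (concat (map g (j # js))) f = sdet (g j) f * sdet (concat (map g js)) f"
    unfolding list.map concat.simps
  proof (rule sdet_append)
    fix x y assume x: "x \<in> set (g j)" and "y \<in> set (concat (map g js))"
    then obtain i where "i \<in> set js" "y \<in> set (g i)" by auto
    with x Cons.prems show "f y x = 0"
      by (metis distinct.simps(2) list.set_intros)
  qed
  moreover have "sdet (concat (map g js)) f = (\<Prod>j\<in>set js. sdet (g j) f)"
    using Cons.prems by (intro Cons.IH) auto
  ultimately show ?case
    using Cons.prems by simp
qed

lemma sdet_mult: "sdet xs A * sdet xs B = sdet xs (\<lambda>i j. \<Sum>k = 0..<length xs. A i (xs ! k) * B (xs ! k) j)"
proof -
  let ?n = "length xs"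
  have "mat ?n ?n (\<lambda>(i, j). A (xs ! i) (xs ! j)) * mat ?n ?n (\<lambda>(i, j). B (xs ! i) (xs ! j))
      = mat ?n ?n (\<lambda>(i, j). \<Sum>k = 0..<?n. A (xs ! i) (xs ! k) * B (xs ! k) (xs ! j))"
    by (rule eq_matI) (simp_all add: scalar_prod_def)
  then show ?thesis
    unfolding sdet_def by (subst det_mult[symmetric]) auto
qed

lemma sdet_mult_distinct:
  assumes "distinct xs"
  shows "sdet xs A * sdet xs B = sdet xs (\<lambda>i j. \<Sum>k\<in>set xs. A i k * B k j)"
  by (simp add: sdet_mult sum_nth_distinct[OF assms, of "\<lambda>k. A _ k * B k _"])

lemma sdet_transpose: "sdet xs (\<lambda>i j. f j i) = sdet xs f"
proof -
  let ?n = "length xs"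
  have "transpose_mat (mat ?n ?n (\<lambda>(i, j). f (xs ! i) (xs ! j))) = mat ?n ?n (\<lambda>(i, j). f (xs ! j) (xs ! i))"
    by (rule eq_matI) simp_all
  then show ?thesis
    unfolding sdet_def by (metis det_transpose mat_carrier)
qed

text \<open>Evaluates the two transformation matrices \<open>E\<close> and \<open>T\<close> of the
  rank one update below, the second after transposition.\<close>

lemma sdet_Cons_triangular:
  fixes f :: "'i \<Rightarrow> 'i \<Rightarrow> 'a::idom"
  assumes "distinct (x # xs)"
    and "\<And>y. y \<in> set xs \<Longrightarrow> f y x = 0"
    and "\<And>y z. y \<in> set xs \<Longrightarrow> z \<in> set xs \<Longrightarrow> f y z = of_bool (y = z)"
  shows "sdet (x # xs) f = f x x"
proof -
  have "sdet ([x] @ xs) f = sdet [x] f * sdet xs f"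
    by (rule sdet_append) (simp add: assms(2))
  moreover have "sdet [x] f = f x x"
    by (subst sdet_diag) simp_all
  moreover have "sdet xs f = 1"
    using assms by (subst sdet_diag) auto
  ultimately show ?thesis by simp
qed

text \<open>A common column sum \<open>e\<close> says that the all-ones row is a left eigenvector.  Both
  determinants are multiples of that of \<open>M\<close> with its first row replaced by ones.\<close>
lemma sdet_rank_one_update:
  fixes M :: "'i \<Rightarrow> 'i \<Rightarrow> 'a::idom"
  assumes xs: "distinct xs" "xs \<noteq> []"
    and col: "\<And>x. x \<in> set xs \<Longrightarrow> (\<Sum>y\<in>set xs. M y x) = e"
  shows "e * sdet xs (\<lambda>y x. M y x + q y) = (e + (\<Sum>y\<in>set xs. q y)) * sdet xs M"
proof -
  obtain z ys where zs: "xs = z # ys"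
    using xs(2) by (cases xs) auto
  define K where "K y x = (if y = z then 1 else M y x)" for y x
  have upd: "sdet xs (\<lambda>y x. M y x + q y) = (e + (\<Sum>y\<in>set xs. q y)) * sdet xs K" for q
  proof -
    define \<mu> where "\<mu> = e + (\<Sum>y\<in>set xs. q y)"
    \<comment> \<open>Multiplication by \<open>E\<close> replaces row \<open>z\<close> by the sum of
      all rows, which is constantly \<open>\<mu>\<close>. The same matrix arises from
      \<open>K\<close> through \<open>T\<close>, which scales the row of ones by
      \<open>\<mu>\<close> and adds \<open>q y\<close> times it to every other row
      \<open>y\<close>.\<close>
    define E where "E y x = (if y = z then 1 else of_bool (y = x) :: 'a)" for y x
    define T where "T y x = (if y = z then if x = z then \<mu> else 0
      else of_bool (y = x) + (if x = z then q y else 0))" for y x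
    have "sdet xs E = 1"
      using xs unfolding zs by (subst sdet_Cons_triangular) (auto simp: E_def)
    moreover have "sdet xs (\<lambda>x y. T y x) = \<mu>"
      using xs unfolding zs by (subst sdet_Cons_triangular) (auto simp: T_def)
    then have "sdet xs T = \<mu>"
      using sdet_transpose[of xs T] by simp
    moreover have "sdet xs E * sdet xs (\<lambda>y x. M y x + q y) = sdet xs T * sdet xs K"
      unfolding sdet_mult_distinct[OF xs(1)]
    proof (rule sdet_cong)
      fix y x assume yx: "y \<in> set xs" "x \<in> set xs"
      have z: "z \<in> set xs" by (simp add: zs)
      show "(\<Sum>k\<in>set xs. E y k * (M k x + q k)) = (\<Sum>k\<in>set xs. T y k * K k x)"
      proof (cases "y = z")
        case True
        have "(\<Sum>k\<in>set xs. T z k * K k x) = (\<Sum>k\<in>set xs. if k = z then \<mu> else 0)"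
          by (intro sum.cong) (auto simp: T_def K_def)
        then show ?thesis
          using True yx z by (simp add: E_def sum.distrib col \<mu>_def)
      next
        case False
        have "(\<Sum>k\<in>set xs. E y k * (M k x + q k)) = (\<Sum>k\<in>set xs. if k = y then M y x + q y else 0)"
          using False by (intro sum.cong) (auto simp: E_def)
        moreover have "(\<Sum>k\<in>set xs. T y k * K k x)
            = (\<Sum>k\<in>set xs. (if k = y then M y x else 0) + (if k = z then q y else 0))"
          using False by (intro sum.cong) (auto simp: T_def K_def)
        ultimately show ?thesis
          using yx z by (simp add: sum.distrib)
      qed
    qed
    ultimately show ?thesis by (simp add: \<mu>_def)
  qed
  show ?thesis
    using upd[of "\<lambda>_. 0"] upd[of q] by simp
qed

lemma sdet_upper_triangular:
  assumes "\<And>i j. j < i \<Longrightarrow> i < n \<Longrightarrow> f i j = 0"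
  shows "sdet [0..<n] f = (\<Prod>i = 0..<n. f i i)"
proof -
  let ?A = "mat n n (\<lambda>(i, j). f i j)"
  have "sdet [0..<n] f = det ?A"
    unfolding sdet_def by (intro arg_cong[where f = det] eq_matI) auto
  also have "\<dots> = prod_list (diag_mat ?A)"
    using assms by (intro det_upper_triangular) (auto simp: upper_triangular_def)
  finally show ?thesis
    by (simp add: prod_list_diag_prod)
qed

section \<open>The action on the affine line and the group determinant\<close>

text \<open>The powers of the generator \<open>1 + i\<close> of the unit group, with
  \<open>lg\<close> as discrete logarithm. Explicit tables make finite checks accessible to
  evaluation.\<close>

definition pw :: "nat \<Rightarrow> f9" where
  "pw k = [(1,0), (1,1), (0,2), (1,2), (2,0), (2,2), (0,1), (2,1)] ! (k mod 8)"

definition lg :: "f9 \<Rightarrow> nat" where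
  "lg x = the (map_of [((1,0),0), ((1,1),1), ((0,2),2), ((1,2),3), ((2,0),4), ((2,2),5), ((0,1),6), ((2,1),7)] x)"

definition units9 :: "f9 list" where
  "units9 = map pw [0..<8]"

lemma units9_eq: "units9 = [(1,0), (1,1), (0,2), (1,2), (2,0), (2,2), (0,1), (2,1)]"
  by (simp add: units9_def upt_rec pw_def)

lemma length_units9 [simp]: "length units9 = 8"
  by (simp add: units9_def)

lemma distinct_units9 [simp]: "distinct units9"
  by (simp add: units9_eq)

lemma F9_eq: "F9 = insert (0, 0) (set units9)"
proof -
  have "{0..2} = {0, 1, 2 :: int}"
    by auto
  then show ?thesis
    by (auto simp: F9_def units9_eq)
qed

lemma zero_notin_units9 [simp]: "(0, 0) \<notin> set units9"
  by (simp add: units9_eq)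

lemma GA19_eq: "GA19 = set units9 \<times> F9"
  by (auto simp: GA19_def F9_eq)

lemma finite_F9 [simp]: "finite F9" and finite_GA19 [simp]: "finite GA19"
  by (simp_all add: F9_eq GA19_eq)

lemma card_GA19: "card GA19 = 72"
  by (simp add: GA19_eq card_cartesian_product F9_eq distinct_card)

lemma pw_mod [simp]: "pw (k mod 8) = pw k"
  by (simp add: pw_def)

lemma pw_in_units9 [simp]: "pw k \<in> set units9"
proof -
  have "pw (k mod 8) \<in> set units9"
    unfolding units9_def by (simp del: pw_mod)
  then show ?thesis by simp
qed

lemma lg_pw [simp]: "lg (pw k) = k mod 8"
proof -
  have "\<forall>i\<in>set [0..<8]. lg (pw i) = i"
    by (simp add: lg_def pw_def upt_rec)
  then have "lg (pw (k mod 8)) = k mod 8"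
    by (simp del: pw_mod)
  then show ?thesis by simp
qed

lemma pw_lg [simp]: "x \<in> set units9 \<Longrightarrow> pw (lg x) = x"
  by (auto simp: units9_def)

lemma lg_less [simp]: "x \<in> set units9 \<Longrightarrow> lg x < 8"
  by (auto simp: units9_def)

lemma pw_mult: "f9_mult (pw i) (pw j) = pw (i + j)"
proof -
  have "\<forall>i\<in>set [0..<8]. \<forall>j\<in>set [0..<8]. f9_mult (pw i) (pw j) = pw (i + j)"
    by code_simp
  then have "f9_mult (pw (i mod 8)) (pw (j mod 8)) = pw (i mod 8 + j mod 8)"
    by (simp del: pw_mod)
  also have "\<dots> = pw ((i mod 8 + j mod 8) mod 8)"
    by (simp only: pw_mod)
  also have "\<dots> = pw (i + j)"
    by (simp only: mod_add_eq pw_mod)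
  finally show ?thesis by simp
qed

lemma f9_mult_units [simp]:
  assumes "x \<in> set units9" "y \<in> set units9"
  shows "f9_mult x y \<in> set units9" and "lg (f9_mult x y) = (lg x + lg y) mod 8"
  using assms by (metis pw_mult pw_in_units9 pw_lg, metis pw_mult lg_pw pw_lg)

lemma f9_mult_commute: "f9_mult x y = f9_mult y x"
  by (simp add: f9_mult_def algebra_simps)

lemma mod3_nested:
  fixes a b x y :: int
  shows "((x mod 3) * a - (y mod 3) * b) mod 3 = (x * a - y * b) mod 3"
    and "((x mod 3) * a + (y mod 3) * b) mod 3 = (x * a + y * b) mod 3"
    and "(a * (x mod 3) - b * (y mod 3)) mod 3 = (a * x - b * y) mod 3"
    and "(a * (x mod 3) + b * (y mod 3)) mod 3 = (a * x + b * y) mod 3"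
  by (rule mod_diff_cong mod_add_cong; simp add: mod_simps)+

lemma f9_mult_assoc: "f9_mult (f9_mult x y) z = f9_mult x (f9_mult y z)"
  by (simp only: f9_mult_def mod3_nested fst_conv snd_conv) (simp add: algebra_simps)

lemma f9_add_assoc: "f9_add (f9_add x y) z = f9_add x (f9_add y z)"
  by (simp add: f9_add_def mod_simps algebra_simps)

lemma f9_distrib: "f9_mult x (f9_add y z) = f9_add (f9_mult x y) (f9_mult x z)"
  by (simp only: f9_mult_def f9_add_def mod3_nested fst_conv snd_conv mod_add_eq) (simp add: algebra_simps)

lemma f9_one_mult: "x \<in> F9 \<Longrightarrow> f9_mult (1, 0) x = x"
  by (auto simp: F9_def f9_mult_def)

lemma f9_mult_zero [simp]: "f9_mult x (0, 0) = (0, 0)"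
  by (simp add: f9_mult_def)

lemma f9_add_zero: "x \<in> F9 \<Longrightarrow> f9_add x (0, 0) = x" "x \<in> F9 \<Longrightarrow> f9_add (0, 0) x = x"
  by (auto simp: F9_def f9_add_def)

lemma f9_add_double: "f9_add x (f9_mult (2, 0) x) = (0, 0)" "f9_add (f9_mult (2, 0) x) x = (0, 0)"
  by (simp_all add: f9_add_def f9_mult_def mod_simps)

lemma f9_closed [simp]: "f9_add x y \<in> F9" "f9_mult x y \<in> F9"
proof -
  have "a mod 3 \<in> {0..2}" for a :: int
    using pos_mod_bound[of 3 a] by auto
  then show "f9_add x y \<in> F9" "f9_mult x y \<in> F9"
    by (auto simp: F9_def f9_add_def f9_mult_def)
qed

section \<open>The affine action and the group laws\<close>

definition act :: "f9 \<times> f9 \<Rightarrow> f9 \<Rightarrow> f9" where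
  "act g x = f9_add (f9_mult (fst g) x) (snd g)"

lemma act_F9 [simp]: "act g x \<in> F9"
  by (simp add: act_def)

lemma ga_mult_act: "ga_mult g h = (f9_mult (fst g) (fst h), act g (snd h))"
  by (simp add: ga_mult_def act_def)

lemma act_ga_mult: "act (ga_mult g h) x = act g (act h x)"
  by (simp add: act_def ga_mult_def f9_mult_assoc f9_distrib f9_add_assoc)

lemma ga_mult_assoc: "ga_mult (ga_mult g h) k = ga_mult g (ga_mult h k)"
  by (simp add: ga_mult_act[of _ k] ga_mult_act[of g "ga_mult h k"] act_ga_mult)
     (simp add: ga_mult_act f9_mult_assoc)

lemma ga_mult_closed [simp]: "g \<in> GA19 \<Longrightarrow> h \<in> GA19 \<Longrightarrow> ga_mult g h \<in> GA19"
  by (auto simp: GA19_eq ga_mult_act)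

lemma ga_one_in [simp]: "ga_one \<in> GA19"
  by (simp add: ga_one_def GA19_eq units9_eq F9_def)

lemma ga_one_mult [simp]: "g \<in> GA19 \<Longrightarrow> ga_mult ga_one g = g" "g \<in> GA19 \<Longrightarrow> ga_mult g ga_one = g"
  by (auto simp: GA19_eq F9_eq ga_one_def ga_mult_def f9_one_mult f9_add_zero f9_mult_commute[of _ "(1, 0)"])

lemma
  assumes g: "g \<in> GA19"
  shows ga_inv_closed [simp]: "ga_inv g \<in> GA19"
    and ga_mult_inv [simp]: "ga_mult g (ga_inv g) = ga_one"
    and ga_inv_mult [simp]: "ga_mult (ga_inv g) g = ga_one"
proof -
  obtain u b where ub: "g = (u, b)" "u \<in> set units9" "b \<in> F9"
    using g by (auto simp: GA19_eq)
  \<comment> \<open>The inverse of \<open>(u, b)\<close> is \<open>(1 / u, - b / u)\<close>, where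
    \<open>1 / u = pw (8 - lg u)\<close> and \<open>(2, 0)\<close> is \<open>-1\<close>.\<close>
  define v where "v = pw (8 - lg u)"
  define h where "h = (v, f9_mult (2, 0) (f9_mult v b))"
  have "f9_mult (pw (lg u)) v = pw 8"
    using lg_less[OF ub(2)] by (simp only: v_def pw_mult) simp
  moreover have "pw 8 = (1, 0)"
    by (simp add: pw_def)
  ultimately have uv: "f9_mult u v = (1, 0)"
    using ub by simp
  then have vu: "f9_mult v u = (1, 0)"
    by (simp add: f9_mult_commute)
  have h: "h \<in> GA19"
    by (simp add: h_def GA19_eq v_def)
  have "f9_mult u (f9_mult (2, 0) (f9_mult v b)) = f9_mult (2, 0) (f9_mult (f9_mult u v) b)"
    by (metis f9_mult_assoc f9_mult_commute)
  then have 1: "ga_mult g h = ga_one"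
    by (simp add: ga_mult_def h_def ub uv ga_one_def f9_one_mult f9_add_double)
  have 2: "ga_mult h g = ga_one"
    by (simp add: ga_mult_def h_def ub vu ga_one_def f9_add_double)
  have "ga_inv g = h"
    unfolding ga_inv_def
  proof (rule the_equality)
    fix k assume k: "k \<in> GA19 \<and> ga_mult g k = ga_one"
    then have "k = ga_mult (ga_mult h g) k"
      by (simp add: 2)
    also have "\<dots> = h"
      using k h by (simp add: ga_mult_assoc)
    finally show "k = h" .
  qed (simp add: h 1)
  then show "ga_inv g \<in> GA19" "ga_mult g (ga_inv g) = ga_one" "ga_mult (ga_inv g) g = ga_one"
    using h 1 2 by simp_all
qed

text \<open>The matrix of \<open>g\<close> on the augmentation sublattice of \<open>\<int>[F9]\<close>
  in the basis \<open>e\<^sub>x - e\<^sub>0\<close>, \<open>x \<noteq> 0\<close>.\<close>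
definition rho :: "f9 \<times> f9 \<Rightarrow> f9 \<Rightarrow> f9 \<Rightarrow> int" where
  "rho g y x = of_bool (y = act g x) - of_bool (y = act g (0, 0))"

lemma rho_zero [simp]: "rho g y (0, 0) = 0"
  by (simp add: rho_def)

lemma sum_units9: "f (0, 0) = 0 \<Longrightarrow> sum f (set units9) = sum f F9"
  by (simp add: F9_eq)

text \<open>Column zero of \<open>rho g\<close> vanishes, so the sum may run over all of
  \<open>F9\<close>, where the indicators in \<open>rho h\<close> select the points
  \<open>act h x\<close> and \<open>act h (0, 0)\<close>.\<close>

lemma rho_mult: "(\<Sum>z\<in>set units9. rho g y z * rho h z x) = rho (ga_mult g h) y x"
proof -
  have "(\<Sum>z\<in>set units9. rho g y z * rho h z x) = (\<Sum>z\<in>F9. rho g y z * rho h z x)"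
    by (rule sum_units9) simp
  also have "\<dots> = (\<Sum>z\<in>F9. rho g y z * of_bool (z = act h x)) - (\<Sum>z\<in>F9. rho g y z * of_bool (z = act h (0, 0)))"
    unfolding rho_def[of h] by (simp add: right_diff_distrib sum_subtractf)
  also have "\<dots> = rho g y (act h x) - rho g y (act h (0, 0))"
    by (simp add: of_bool_def if_distrib[of "\<lambda>c. _ * c"] cong: if_cong)
  also have "\<dots> = rho (ga_mult g h) y x"
    by (simp add: rho_def act_ga_mult)
  finally show ?thesis .
qed

text \<open>The trace is the number of fixed points minus 1. The identity fixes 9 points, any other
  translation none, and \<open>u x + b\<close> with \<open>u\<close> different from 1 exactly
  one.\<close>

lemma rho_trace:
  assumes "g \<in> GA19"
  shows "(\<Sum>x\<in>set units9. rho g x x) = 9 * of_bool (g = ga_one) - of_bool (fst g = (1, 0))"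
proof -
  have check: "\<forall>u\<in>set units9. \<forall>b\<in>set ((0, 0) # units9).
      sum_list (map (\<lambda>x. rho (u, b) x x) units9) = 9 * of_bool ((u, b) = ga_one) - of_bool (u = (1, 0))"
    by code_simp
  obtain u b where "g = (u, b)" "u \<in> set units9" "b \<in> set ((0, 0) # units9)"
    using assms by (auto simp: GA19_eq F9_eq)
  with check[rule_format, of u b] show ?thesis
    by (simp only: fst_conv sum_list_distinct_conv_sum_set[OF distinct_units9])
qed

section \<open>Block decomposition of the regular representation\<close>

lemma mod8_shift:
  fixes m l c :: nat
  assumes "m < 8" "l < 8" "c < 8"
  shows "(m + l) mod 8 = c \<longleftrightarrow> m = (c + 8 - l) mod 8"
proof -
  have "(m + l) mod 8 = (if m + l < 8 then m + l else m + l - 8)"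
    using assms by (simp add: le_mod_geq)
  moreover have "(c + 8 - l) mod 8 = (if l \<le> c then c - l else c + 8 - l)"
    using assms by (simp add: le_mod_geq)
  ultimately show ?thesis
    using assms by auto
qed

text \<open>The summand 8 keeps the subtraction of naturals from truncating for
  \<open>j < 8\<close>.\<close>

definition circ :: "(nat \<Rightarrow> 'a) \<Rightarrow> nat \<Rightarrow> nat \<Rightarrow> 'a" where
  "circ c i j = c ((i + 8 - j) mod 8)"

text \<open>Coefficients of the image of \<open>a\<close> in the group ring of \<open>C8\<close>,
  the quotient by the translations.\<close>

definition quot_coeff :: "(f9 \<times> f9 \<Rightarrow> int) \<Rightarrow> nat \<Rightarrow> int" where
  "quot_coeff a c = (\<Sum>g\<in>GA19. a g * of_bool (lg (fst g) = c))"

definition rho_mat :: "(f9 \<times> f9 \<Rightarrow> int) \<Rightarrow> f9 \<Rightarrow> f9 \<Rightarrow> int" where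
  "rho_mat a y x = (\<Sum>g\<in>GA19. a g * rho g y x)"

text \<open>\<open>rep\<close> is the isomorphism \<open>\<rat>[G] \<rightarrow> \<rat>[C\<^sub>8] \<times> M\<^sub>8(\<rat>)\<close> in coordinates.\<close>
fun rep :: "nat + f9 \<times> f9 \<Rightarrow> f9 \<times> f9 \<Rightarrow> int" where
  "rep (Inl c) g = of_bool (lg (fst g) = c)"
| "rep (Inr (y, x)) g = rho g y x"

fun rep_inv :: "f9 \<times> f9 \<Rightarrow> nat + f9 \<times> f9 \<Rightarrow> int" where
  "rep_inv g (Inl c) = of_bool (lg (fst g) = c)"
| "rep_inv g (Inr (y, x)) = rho (ga_inv g) x y"

fun rep_block :: "(f9 \<times> f9 \<Rightarrow> int) \<Rightarrow> nat + f9 \<times> f9 \<Rightarrow> nat + f9 \<times> f9 \<Rightarrow> int" where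
  "rep_block a (Inl c) (Inl c') = circ (quot_coeff a) c c'"
| "rep_block a (Inr (y, x)) (Inr (z, x')) = of_bool (x = x') * rho_mat a y z"
| "rep_block a _ _ = 0"

definition rep_index :: "(nat + f9 \<times> f9) list" where
  "rep_index = map Inl [0..<8] @ concat (map (\<lambda>x. map (\<lambda>y. Inr (y, x)) units9) units9)"

lemma set_rep_index: "set rep_index = {0..<8} <+> set units9 \<times> set units9"
  by (auto simp: rep_index_def Plus_def)

lemma length_rep_index: "length rep_index = 72"
  by (simp add: rep_index_def length_concat comp_def sum_list_triv)

lemma distinct_rep_index: "distinct rep_index"
  by (rule card_distinct)
     (simp add: set_rep_index card_Plus card_cartesian_product distinct_card length_rep_index)

lemma sum_rep_index: "sum f (set rep_index)
    = (\<Sum>c = 0..<8. f (Inl c)) + (\<Sum>y\<in>set units9. \<Sum>x\<in>set units9. f (Inr (y, x)))"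
  by (simp add: set_rep_index sum.Plus sum.cartesian_product)

text \<open>Substituting \<open>ga_mult g h\<close> for \<open>g\<close> moves \<open>h\<close> from
  the argument of \<open>a\<close> into \<open>rep\<close>, whose multiplicativity then splits off
  the factor \<open>rep t' h\<close>.\<close>

lemma rep_intertwine:
  assumes t: "t \<in> set rep_index" and h: "h \<in> GA19"
  shows "(\<Sum>g\<in>GA19. rep t g * a (ga_mult g (ga_inv h)))
       = (\<Sum>t'\<in>set rep_index. rep_block a t t' * rep t' h)"
proof -
  have "(\<Sum>g\<in>GA19. rep t g * a (ga_mult g (ga_inv h))) = (\<Sum>g\<in>GA19. a g * rep t (ga_mult g h))"
    by (rule sum.reindex_bij_witness[of _ "\<lambda>g. ga_mult g h" "\<lambda>g. ga_mult g (ga_inv h)"])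
       (simp_all add: h ga_mult_assoc)
  also have "\<dots> = (\<Sum>t'\<in>set rep_index. rep_block a t t' * rep t' h)"
  proof (cases t)
    case (Inl c)
    then have c: "c < 8"
      using t by (auto simp: set_rep_index)
    have hu: "fst h \<in> set units9"
      using h by (auto simp: GA19_eq)
    have mod: "(m + lg (fst h)) mod 8 = c \<longleftrightarrow> m = (c + 8 - lg (fst h)) mod 8" if "m < 8" for m
      using mod8_shift[OF that lg_less[OF hu] c] .
    have "(\<Sum>g\<in>GA19. a g * rep t (ga_mult g h))
        = (\<Sum>g\<in>GA19. a g * of_bool (lg (fst g) = (c + 8 - lg (fst h)) mod 8))"
      by (intro sum.cong refl) (simp add: Inl GA19_eq mem_Times_iff ga_mult_act hu mod)
    also have "\<dots> = circ (quot_coeff a) c (lg (fst h))"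
      by (simp add: circ_def quot_coeff_def)
    also have "\<dots> = (\<Sum>t'\<in>set rep_index. rep_block a t t' * rep t' h)"
      using Inl lg_less[OF hu]
      by (simp add: sum_rep_index of_bool_def if_distrib[of "\<lambda>c. _ * c"] cong: if_cong)
    finally show ?thesis .
  next
    case (Inr p)
    obtain y x where p: "p = (y, x)" "y \<in> set units9" "x \<in> set units9"
      using Inr t by (auto simp: set_rep_index)
    have "(\<Sum>g\<in>GA19. a g * rep t (ga_mult g h)) = (\<Sum>g\<in>GA19. a g * (\<Sum>z\<in>set units9. rho g y z * rho h z x))"
      by (simp add: Inr p rho_mult)
    also have "\<dots> = (\<Sum>z\<in>set units9. rho_mat a y z * rho h z x)"
      unfolding rho_mat_def sum_distrib_left sum_distrib_right
      by (subst sum.swap) (simp add: mult.assoc)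
    also have "\<dots> = (\<Sum>t'\<in>set rep_index. rep_block a t t' * rep t' h)"
      by (simp add: Inr p sum_rep_index of_bool_def if_distrib[of "\<lambda>c. c * _"] if_distrib[of "\<lambda>c. _ * c"] cong: if_cong)
    finally show ?thesis .
  qed
  finally show ?thesis .
qed

lemma lg_eq_iff: "x \<in> set units9 \<Longrightarrow> y \<in> set units9 \<Longrightarrow> lg x = lg y \<longleftrightarrow> x = y"
  by (metis pw_lg)

text \<open>Fourier inversion up to the factor 9. The \<open>Inl\<close> part indicates that
  \<open>g\<close> and \<open>h\<close> agree modulo translations; the \<open>Inr\<close> part is
  the trace of \<open>rho\<close> at \<open>ga_mult (ga_inv g) h\<close>, where
  \<open>rho_trace\<close> subtracts the same indicator.\<close>

lemma rep_inv_rep: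
  assumes g: "g \<in> GA19" and h: "h \<in> GA19"
  shows "(\<Sum>t\<in>set rep_index. rep_inv g t * rep t h) = (if g = h then 9 else 0)"
proof -
  have u: "fst g \<in> set units9" "fst h \<in> set units9" "fst (ga_inv g) \<in> set units9"
    using g h ga_inv_closed[OF g] by (auto simp: GA19_eq)
  have gh: "ga_mult g (ga_mult (ga_inv g) h) = h"
    using g h by (simp flip: ga_mult_assoc)
  have eq_one: "ga_mult (ga_inv g) h = ga_one \<longleftrightarrow> g = h"
    using g h gh by auto
  have "fst (ga_mult (ga_inv g) h) = (1, 0)" if "fst g = fst h"
    using arg_cong[OF ga_inv_mult[OF g], of fst] that by (simp add: ga_mult_act ga_one_def)
  moreover have "fst g = fst h" if "fst (ga_mult (ga_inv g) h) = (1, 0)"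
    using arg_cong[OF gh, of fst] that u
    by (simp add: ga_mult_act f9_mult_commute[of _ "(1, 0)"] f9_one_mult F9_eq)
  ultimately have eq_fst: "fst (ga_mult (ga_inv g) h) = (1, 0) \<longleftrightarrow> fst g = fst h"
    by blast
  have "(\<Sum>y\<in>set units9. \<Sum>x\<in>set units9. rho (ga_inv g) x y * rho h y x)
      = (\<Sum>x\<in>set units9. rho (ga_mult (ga_inv g) h) x x)"
    by (subst sum.swap) (simp add: rho_mult)
  also have "\<dots> = 9 * of_bool (g = h) - of_bool (fst g = fst h)"
    using g h by (simp add: rho_trace eq_one eq_fst)
  finally have "(\<Sum>y\<in>set units9. \<Sum>x\<in>set units9. rho (ga_inv g) x y * rho h y x)
      = 9 * of_bool (g = h) - of_bool (fst g = fst h)" .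
  moreover have "(\<Sum>c = 0..<8. of_bool (lg (fst g) = c) * of_bool (lg (fst h) = c)) = (of_bool (fst g = fst h) :: int)"
    using u by (simp add: of_bool_def if_distrib[of "\<lambda>c. _ * c"] if_distrib[of "\<lambda>c. c * _"] lg_eq_iff cong: if_cong)
  ultimately show ?thesis
    by (simp add: sum_rep_index)
qed

text \<open>Left multiplication acts in the same way on each of the eight columns of a matrix in the
  second block. This is where the exponent 8 comes from.\<close>

lemma sdet_rep_block:
  "sdet rep_index (rep_block a) = sdet [0..<8] (circ (quot_coeff a)) * sdet units9 (rho_mat a) ^ 8"
proof -
  have "sdet rep_index (rep_block a) = sdet (map Inl [0..<8]) (rep_block a)
      * sdet (concat (map (\<lambda>x. map (\<lambda>y. Inr (y, x)) units9) units9)) (rep_block a)"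
    unfolding rep_index_def by (rule sdet_append) auto
  also have "sdet (map Inl [0..<8]) (rep_block a) = sdet [0..<8] (circ (quot_coeff a))"
    by (simp add: sdet_map)
  also have "sdet (concat (map (\<lambda>x. map (\<lambda>y. Inr (y, x)) units9) units9)) (rep_block a)
      = (\<Prod>x\<in>set units9. sdet (map (\<lambda>y. Inr (y, x)) units9) (rep_block a))"
    by (rule sdet_concat) auto
  also have "\<dots> = sdet units9 (rho_mat a) ^ 8"
    by (simp add: sdet_map distinct_card)
  finally show ?thesis .
qed

theorem group_det_GA19:
  "group_det GA19 ga_mult ga_inv a
     = sdet [0..<8] (circ (quot_coeff a)) * sdet units9 (rho_mat a) ^ 8"
proof -
  define gs where "gs = group_enum GA19"
  have "\<exists>gs. distinct gs \<and> set gs = GA19"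
    using finite_distinct_list[OF finite_GA19] by blast
  then have gs: "distinct gs" "set gs = GA19"
    unfolding gs_def group_enum_def by (metis (mono_tags, lifting) someI_ex)+
  then have len: "length rep_index = length gs"
    by (metis card_GA19 distinct_card length_rep_index)
  have "9 ^ length gs * sdet gs (\<lambda>g h. a (ga_mult g (ga_inv h))) = 9 ^ length gs * sdet rep_index (rep_block a)"
    using gs len by (intro sdet_intertwine[where W = rep and V = rep_inv])
      (simp_all add: distinct_rep_index rep_intertwine rep_inv_rep)
  \<comment> \<open>The power of 9 is a nonzero integer and cancels.\<close>
  then have "sdet gs (\<lambda>g h. a (ga_mult g (ga_inv h))) = sdet rep_index (rep_block a)"
    by simp
  moreover have "group_det GA19 ga_mult ga_inv a = sdet gs (\<lambda>g h. a (ga_mult g (ga_inv h)))"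
    by (simp add: group_det_def sdet_def gs_def Let_def)
  ultimately show ?thesis
    by (simp add: sdet_rep_block)
qed

section \<open>Circulant determinants of order 8\<close>

lemma power_mod_8:
  fixes s :: "'a::monoid_mult"
  assumes "s ^ 8 = 1"
  shows "s ^ (n mod 8) = s ^ n"
proof -
  have "s ^ n = s ^ (8 * (n div 8) + n mod 8)"
    by simp
  also have "\<dots> = s ^ (n mod 8)"
    by (simp only: power_add power_mult assms power_one mult_1_left)
  finally show ?thesis by simp
qed

text \<open>The ring is kept general because the Fourier transform is used both over the complex
  numbers and in the Galois ring modulo 9.\<close>

context
  fixes t :: "'a::comm_ring_1"
  assumes t4: "t ^ 4 = -1"
begin

lemma root8_pow8: "(t ^ k) ^ 8 = 1"
proof -
  have "(t ^ k) ^ 8 = ((t ^ 4) ^ 2) ^ k"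
    by (simp flip: power_mult add: mult.commute)
  then show ?thesis by (simp add: t4)
qed

text \<open>With zero divisors present, \<open>1 - t ^ m\<close> cannot be cancelled from the
  geometric sum. Instead the sum factors as \<open>(1 + r) (1 + r ^ 2) (1 + r ^ 4)\<close> for
  \<open>r = t ^ m\<close>; unless 8 divides \<open>m\<close>, one factor vanishes, and the power of
  2 in \<open>m\<close> tells which.\<close>

lemma root8_sum: "(\<Sum>k = 0..<8. (t ^ m) ^ k) = (if 8 dvd m then 8 else 0)"
proof -
  have fact: "(\<Sum>k = 0..<8. r ^ k) = (1 + r) * (1 + r ^ 2) * (1 + r ^ 4)" for r :: 'a
    by (simp add: eval_nat_numeral algebra_simps)
  consider "odd m" | n where "m = 2 * n" "odd n" | n where "m = 4 * n" "odd n" | n where "m = 8 * n"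
  proof (cases "odd m")
    case False
    then obtain a where a: "m = 2 * a" by auto
    show ?thesis
    proof (cases "odd a")
      case False
      then obtain b where b: "a = 2 * b" by auto
      show ?thesis
      proof (cases "odd b")
        case True
        then show ?thesis using that(3)[of b] by (simp add: a b)
      next
        case False
        then obtain n where "b = 2 * n" by auto
        then show ?thesis using that(4)[of n] by (simp add: a b)
      qed
    qed (use that(2) a in simp)
  qed (use that(1) in simp)
  then show ?thesis
  proof cases
    case 1
    then have "(t ^ m) ^ 4 = -1"
      using t4 by (metis mult.commute power_mult power_minus_odd power_one)
    moreover have "\<not> 8 dvd m"
      using 1 by presburger
    ultimately show ?thesis by (simp add: fact)
  next
    case 2
    then have "(t ^ m) ^ 2 = (t ^ 4) ^ n"
      by (simp flip: power_mult add: mult.commute)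
    then have "(t ^ m) ^ 2 = -1"
      using 2 t4 by simp
    moreover have "\<not> 8 dvd m"
      using 2 by presburger
    ultimately show ?thesis by (simp add: fact)
  next
    case 3
    then have "t ^ m = -1"
      using t4 by (simp add: power_mult)
    moreover have "\<not> 8 dvd m"
      using 3 by presburger
    ultimately show ?thesis by (simp add: fact)
  next
    case 4
    then have "t ^ m = 1"
      using root8_pow8[of n] by (simp flip: power_mult add: mult.commute)
    then show ?thesis using 4 by simp
  qed
qed

lemma fourier_inverse:
  assumes "j < 8" "j' < 8"
  shows "(\<Sum>k = 0..<8. t ^ (k * (8 - j)) * t ^ (k * j')) = (if j = j' then 8 else 0)"
proof -
  have "(\<Sum>k = 0..<8. t ^ (k * (8 - j)) * t ^ (k * j')) = (\<Sum>k = 0..<8. (t ^ (8 - j + j')) ^ k)"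
    by (simp flip: power_mult power_add add: algebra_simps)
  moreover have "8 dvd 8 - j + j' \<longleftrightarrow> j = j'"
    using assms by presburger
  ultimately show ?thesis
    using root8_sum[of "8 - j + j'"] by simp
qed

text \<open>The characters of \<open>C8\<close> diagonalize a circulant. The factor
  \<open>8 ^ 8\<close> cancels over the complex numbers and equals 1 modulo 9.\<close>

lemma fourier_circ:
  "8 ^ 8 * sdet [0..<8] (circ c) = 8 ^ 8 * (\<Prod>k = 0..<8. \<Sum>j = 0..<8. c j * (t ^ k) ^ j)"
proof -
  let ?D = "\<lambda>k m. if k = m then \<Sum>j = 0..<8. c j * (t ^ k) ^ j else 0"
  have "8 ^ length [0..<8] * sdet [0..<8] (circ c) = 8 ^ length [0..<8] * sdet [0..<8] ?D"
  proof (rule sdet_intertwine[where W = "\<lambda>k j. t ^ (k * j)" and V = "\<lambda>j k. t ^ (k * (8 - j))"])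
    fix k j :: nat assume "k \<in> set [0..<8]" and "j \<in> set [0..<8]"
    then have kj: "k < 8" "j < 8" by simp_all
    have "(\<Sum>i = 0..<8. t ^ (k * i) * circ c i j) = (\<Sum>m = 0..<8. c m * (t ^ k) ^ m * (t ^ k) ^ j)"
    proof (rule sum.reindex_bij_witness[of _ "\<lambda>m. (m + j) mod 8" "\<lambda>i. (i + 8 - j) mod 8"])
      fix i :: nat assume "i \<in> {0..<8}"
      then have i: "i < 8" by simp
      have "(t ^ k) ^ ((i + 8 - j) mod 8) * (t ^ k) ^ j = (t ^ k) ^ (i + 8)"
        using kj by (simp add: power_mod_8[OF root8_pow8] flip: power_add)
      also have "\<dots> = (t ^ k) ^ i"
        by (simp add: power_add root8_pow8)
      finally have *: "(t ^ k) ^ ((i + 8 - j) mod 8) * (t ^ k) ^ j = (t ^ k) ^ i" .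
      show "c ((i + 8 - j) mod 8) * (t ^ k) ^ ((i + 8 - j) mod 8) * (t ^ k) ^ j = t ^ (k * i) * circ c i j"
        unfolding mult.assoc * circ_def power_mult by (rule mult.commute)
      show "((i + 8 - j) mod 8 + j) mod 8 = i"
        using mod8_shift[of "(i + 8 - j) mod 8" j i] i kj by simp
    next
      fix m :: nat assume "m \<in> {0..<8}"
      then show "((m + j) mod 8 + 8 - j) mod 8 = m"
        using mod8_shift[of m j "(m + j) mod 8"] kj by simp
    qed auto
    also have "\<dots> = (\<Sum>m = 0..<8. ?D k m * t ^ (m * j))"
      using kj by (simp add: if_distrib[of "\<lambda>c. c * _"] power_mult sum_distrib_right cong: if_cong)
    finally show "(\<Sum>i\<in>set [0..<8]. t ^ (k * i) * circ c i j) = (\<Sum>m\<in>set [0..<8]. ?D k m * t ^ (m * j))"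
      by simp
  qed (simp_all add: fourier_inverse)
  also have "sdet [0..<8] ?D = (\<Prod>k = 0..<8. \<Sum>j = 0..<8. c j * (t ^ k) ^ j)"
    by (subst sdet_diag) simp_all
  finally show ?thesis by simp
qed

end

section \<open>The factored circulant determinant and its parity\<close>

lemma upt8_eq: "{0..<8} = {0, 1, 2, 3, 4, 5, 6, 7 :: nat}"
  by auto

lemma sum_upt8: "sum f {0..<8 :: nat} = f 0 + f 1 + f 2 + f 3 + f 4 + f 5 + f 6 + f 7"
  by (simp add: upt8_eq add_ac)

lemma prod_upt8: "prod f {0..<8 :: nat} = f 0 * f 1 * f 2 * f 3 * f 4 * f 5 * f 6 * f 7"
  by (simp add: upt8_eq mult_ac)

text \<open>A norm taken in two stages. Reduction by \<open>s ^ 4 = -1\<close> leaves a cubic in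
  \<open>s\<close>; pairing \<open>s\<close> with \<open>- s\<close> gives
  \<open>P + Q * s^2\<close>, and passing from \<open>t\<close> to \<open>t ^ 3\<close> changes the
  sign of \<open>s^2\<close>, so the full product is
  \<open>P^2 - Q^2 * t ^ 4 = P^2 + Q^2\<close>.\<close>

lemma primitive_root8_prod:
  fixes t :: "'a::comm_ring_1" and c :: "nat \<Rightarrow> 'a"
  assumes t4: "t ^ 4 = -1"
  defines "f \<equiv> \<lambda>s. \<Sum>j = 0..<8. c j * s ^ j"
  shows "f t * f (- t) * (f (t ^ 3) * f (- (t ^ 3))) =
    ((c 0 - c 4)^2 - (c 2 - c 6)^2 + 2 * (c 1 - c 5) * (c 3 - c 7))^2 +
    (2 * (c 0 - c 4) * (c 2 - c 6) - (c 1 - c 5)^2 + (c 3 - c 7)^2)^2"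
proof -
  define w where "w j = c j - c (j + 4)" for j
  define P where "P = (w 0)^2 - (w 2)^2 + 2 * w 1 * w 3"
  define Q where "Q = 2 * w 0 * w 2 - (w 1)^2 + (w 3)^2"
  have fw: "f s = w 0 + w 1 * s + w 2 * s^2 + w 3 * s^3" if "s ^ 4 = -1" for s
  proof -
    have "f s = c 0 + c 1 * s + c 2 * s^2 + c 3 * s^3 + s ^ 4 * (c 4 + c 5 * s + c 6 * s^2 + c 7 * s^3)"
      by (simp add: f_def sum_upt8 eval_nat_numeral algebra_simps)
    then show ?thesis
      by (simp add: that w_def algebra_simps)
  qed
  have pair: "f s * f (- s) = P + Q * s^2" if s: "s ^ 4 = -1" for s
  proof -
    have s': "(- s) ^ 4 = -1" using s by simp
    have "f s * f (- s) = (w 0)^2 + (2 * w 0 * w 2 - (w 1)^2) * s^2 + ((w 2)^2 - 2 * w 1 * w 3) * s^4 - (w 3)^2 * (s^4 * s^2)"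
      unfolding fw[OF s] fw[OF s'] by (simp add: eval_nat_numeral algebra_simps)
    also have "\<dots> = P + Q * s^2"
      unfolding s by (simp add: P_def Q_def algebra_simps)
    finally show ?thesis .
  qed
  have "(t ^ 3) ^ 4 = (t ^ 4) ^ 3" "(t ^ 3)^2 = t ^ 4 * t^2"
    by (simp_all flip: power_mult power_add)
  then have t3: "(t ^ 3) ^ 4 = -1" "(t ^ 3)^2 = - (t^2)"
    by (simp_all add: t4)
  have "f t * f (- t) * (f (t ^ 3) * f (- (t ^ 3))) = P^2 - Q^2 * (t^2 * t^2)"
    unfolding pair[OF t4] pair[OF t3(1)] t3(2) by (simp add: power2_eq_square algebra_simps)
  also have "\<dots> = P^2 + Q^2"
    using t4 by (simp flip: power_add)
  finally show ?thesis
    by (simp add: P_def Q_def w_def)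
qed

text \<open>The eigenvalues are grouped by the order of the root of unity: 1, -1, the pair of order
  4 and the four of order 8. Each group multiplies to an integer.\<close>

lemma det_circ:
  fixes c :: "nat \<Rightarrow> int"
  shows "sdet [0..<8] (circ c) =
    (c 0 + c 2 + c 4 + c 6 + (c 1 + c 3 + c 5 + c 7)) *
    (c 0 + c 2 + c 4 + c 6 - (c 1 + c 3 + c 5 + c 7)) *
    ((c 0 - c 2 + c 4 - c 6)^2 + (c 1 - c 3 + c 5 - c 7)^2) *
    (((c 0 - c 4)^2 - (c 2 - c 6)^2 + 2 * (c 1 - c 5) * (c 3 - c 7))^2 +
     (2 * (c 0 - c 4) * (c 2 - c 6) - (c 1 - c 5)^2 + (c 3 - c 7)^2)^2)" (is "_ = ?A * ?B * ?C * ?D")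
proof -
  define t where "t = cis (pi / 4)"
  have t4: "t ^ 4 = -1"
    by (simp add: t_def DeMoivre cis_pi)
  define d where "d j = (of_int (c j) :: complex)" for j
  define f where "f s = (\<Sum>j = 0..<8. d j * s ^ j)" for s
  have t_step: "t ^ (n + 4) = - (t ^ n)" for n
    by (simp only: power_add t4) simp
  define u where "u = t^2"
  have u2: "u^2 = -1"
    using t4 by (simp add: u_def flip: power_mult)
  have u_step: "u ^ (n + 2) = - (u ^ n)" for n
    by (simp only: power_add u2) simp
  have u_pow: "u ^ 3 = - u" "u ^ 4 = 1" "u ^ 5 = u" "u ^ 6 = -1" "u ^ 7 = - u"
    using u_step[of 1] u_step[of 2] u_step[of 3] u_step[of 4] u_step[of 5] u2
    by (simp_all add: power3_eq_cube mult.assoc)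
  have "f 1 = of_int ?A" "f (-1) = of_int ?B"
    by (simp_all add: f_def d_def sum_upt8)
  moreover have "f u * f (- u) = of_int ?C"
  proof -
    have fu: "f u = (d 0 - d 2 + d 4 - d 6) + (d 1 - d 3 + d 5 - d 7) * u"
      "f (- u) = (d 0 - d 2 + d 4 - d 6) - (d 1 - d 3 + d 5 - d 7) * u"
      by (simp_all add: f_def sum_upt8 u2 u_pow algebra_simps)
    have "f u * f (- u) = (d 0 - d 2 + d 4 - d 6)^2 - (d 1 - d 3 + d 5 - d 7)^2 * u^2"
      unfolding fu by (simp add: power2_eq_square algebra_simps)
    then show ?thesis
      by (simp add: u2 d_def)
  qed
  moreover have "f t * f (- t) * (f (t ^ 3) * f (- (t ^ 3))) = of_int ?D"
    using primitive_root8_prod[OF t4, of d] by (simp add: f_def d_def)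
  moreover have "(\<Prod>k = 0..<8. f (t ^ k)) =
      f 1 * f (-1) * (f u * f (- u)) * (f t * f (- t) * (f (t ^ 3) * f (- (t ^ 3))))"
  proof -
    have "t ^ 5 = - t" "t ^ 6 = - u" "t ^ 7 = - (t ^ 3)"
      using t_step[of 1] t_step[of 2] t_step[of 3] by (simp_all add: u_def)
    then show ?thesis
      by (simp add: prod_upt8 t4 mult_ac flip: u_def)
  qed
  moreover have "of_int (sdet [0..<8] (circ c)) = sdet [0..<8] (circ d)"
    by (auto simp: of_int_sdet circ_def d_def intro!: sdet_cong)
  moreover have "sdet [0..<8] (circ d) = (\<Prod>k = 0..<8. f (t ^ k))"
    using fourier_circ[OF t4, of d] by (simp add: f_def)
  ultimately have "(of_int (sdet [0..<8] (circ c)) :: complex) = of_int (?A * ?B * ?C * ?D)"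
    by (simp only: of_int_mult mult_ac)
  then show ?thesis
    by (simp only: of_int_eq_iff)
qed

text \<open>All four factors have the parity of \<open>S + T\<close>, so all are even once one is.
  The first three together contribute 16: for even \<open>S\<close> as 2, 2 and 4, for odd
  \<open>S\<close> as 8 from the difference of two odd squares and 2 from \<open>p^2 + q^2\<close>.
  The last contributes 2.\<close>

lemma det_circ_even:
  fixes c :: "nat \<Rightarrow> int"
  assumes "even (sdet [0..<8] (circ c))"
  shows "32 dvd sdet [0..<8] (circ c)"
proof -
  define S T p q N where "S = c 0 + c 2 + c 4 + c 6" and "T = c 1 + c 3 + c 5 + c 7"
    and "p = c 0 - c 2 + c 4 - c 6" and "q = c 1 - c 3 + c 5 - c 7"
    and "N = ((c 0 - c 4)^2 - (c 2 - c 6)^2 + 2 * (c 1 - c 5) * (c 3 - c 7))^2 +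
     (2 * (c 0 - c 4) * (c 2 - c 6) - (c 1 - c 5)^2 + (c 3 - c 7)^2)^2"
  note defs = this
  have A: "sdet [0..<8] (circ c) = (S + T) * (S - T) * (p^2 + q^2) * N"
    by (simp add: det_circ defs)
  have par: "even p \<longleftrightarrow> even S" "even q \<longleftrightarrow> even T" "even N \<longleftrightarrow> even (S + T)"
    by (auto simp: defs)
  have ST: "even (S + T)"
    using assms unfolding A by (auto simp: par)
  have "16 dvd (S + T) * (S - T) * (p^2 + q^2)"
  proof (cases "even S")
    case True
    then have "even T" using ST by simp
    with True par have d: "2 dvd S + T" "2 dvd S - T" "2 dvd p" "2 dvd q"
      by simp_all
    have "2 * 2 * (2 * 2) dvd (S + T) * (S - T) * (p * p + q * q)"
      by (intro mult_dvd_mono[OF mult_dvd_mono[OF d(1,2)]] dvd_add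
          mult_dvd_mono[OF d(3,3)] mult_dvd_mono[OF d(4,4)])
    then show ?thesis by (simp add: power2_eq_square)
  next
    case False
    then have "odd T" using ST by simp
    then obtain a b where ab: "S = 2 * a + 1" "T = 2 * b + 1"
      using False by (meson oddE)
    \<comment> \<open>The two factors have opposite parity.\<close>
    have "2 dvd (a + b + 1) * (a - b)" by auto
    then have "4 * 2 dvd 4 * ((a + b + 1) * (a - b))"
      by (intro mult_dvd_mono) auto
    moreover have "(S + T) * (S - T) = 4 * ((a + b + 1) * (a - b))"
      by (simp add: ab algebra_simps)
    moreover have "2 dvd p^2 + q^2"
      using par False \<open>odd T\<close> by simp
    ultimately have "4 * 2 * 2 dvd (S + T) * (S - T) * (p^2 + q^2)"
      by (metis mult_dvd_mono)
    then show ?thesis by simp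
  qed
  moreover have "2 dvd N" using ST par by simp
  ultimately have "16 * 2 dvd (S + T) * (S - T) * (p^2 + q^2) * N"
    by (rule mult_dvd_mono)
  then show ?thesis by (simp add: A)
qed

section \<open>The congruence modulo 9\<close>

text \<open>The Galois ring \<open>\<int>[i] / 9\<close>, with residue field \<open>F9\<close>.\<close>
quotient_type gr9 = "int \<times> int" /
  "\<lambda>p q. fst p mod 9 = fst q mod 9 \<and> snd p mod 9 = snd q mod 9"
  by (auto intro!: equivpI reflpI sympI transpI)

instantiation gr9 :: comm_ring_1
begin

lift_definition zero_gr9 :: gr9 is "(0, 0)" .
lift_definition one_gr9 :: gr9 is "(1, 0)" .
lift_definition plus_gr9 :: "gr9 \<Rightarrow> gr9 \<Rightarrow> gr9" is
  "\<lambda>p q. (fst p + fst q, snd p + snd q)"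
  by (auto intro: mod_add_cong)
lift_definition uminus_gr9 :: "gr9 \<Rightarrow> gr9" is "\<lambda>p. (- fst p, - snd p)"
  by (auto intro: mod_minus_cong)
lift_definition minus_gr9 :: "gr9 \<Rightarrow> gr9 \<Rightarrow> gr9" is
  "\<lambda>p q. (fst p - fst q, snd p - snd q)"
  by (auto intro: mod_diff_cong)
lift_definition times_gr9 :: "gr9 \<Rightarrow> gr9 \<Rightarrow> gr9" is
  "\<lambda>p q. (fst p * fst q - snd p * snd q, fst p * snd q + snd p * fst q)"
  by (auto intro!: mod_diff_cong mod_add_cong intro: mod_mult_cong)

instance
  by standard (transfer, simp add: algebra_simps)+

end

lift_definition Gr :: "int \<Rightarrow> int \<Rightarrow> gr9" is "\<lambda>a b. (a, b)" .

lemma Gr_eq_iff: "Gr a b = Gr c d \<longleftrightarrow> a mod 9 = c mod 9 \<and> b mod 9 = d mod 9"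
  by transfer simp

lemma Gr_arith:
  "Gr a b + Gr c d = Gr (a + c) (b + d)"
  "Gr a b - Gr c d = Gr (a - c) (b - d)"
  "- Gr a b = Gr (- a) (- b)"
  "Gr a b * Gr c d = Gr (a * c - b * d) (a * d + b * c)"
  by (transfer, simp)+

lemma Gr_0: "0 = Gr 0 0" and Gr_1: "1 = Gr 1 0"
  by (transfer, simp)+

lemma of_nat_gr9: "of_nat n = Gr (int n) 0"
  by (induction n) (simp_all add: Gr_0 Gr_1 Gr_arith)

lemma of_int_gr9: "of_int n = Gr n 0"
  by (cases n rule: int_cases2) (simp_all add: of_nat_gr9 Gr_arith)

lemma of_int_gr9_eq_iff: "(of_int m :: gr9) = of_int n \<longleftrightarrow> m mod 9 = n mod 9"
  by (simp add: of_int_gr9 Gr_eq_iff)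

lemma nine_gr9: "(9 :: gr9) = 0" and eight_gr9: "(8 :: gr9) = -1"
  using of_int_gr9_eq_iff[of 9 0] of_int_gr9_eq_iff[of 8 "-1"] by simp_all

lemma Gr_sum: "(\<Sum>i\<in>A. Gr (f i) (g i)) = Gr (sum f A) (sum g A)"
  by (induction A rule: infinite_finite_induct) (simp_all add: Gr_0 Gr_arith)

lemma three_dvd_Gr:
  assumes "3 dvd a" "3 dvd b"
  shows "3 dvd Gr a b"
proof -
  obtain c d where "a = 3 * c" "b = 3 * d"
    using assms unfolding dvd_def by blast
  then have "Gr a b = Gr 3 0 * Gr c d"
    by (simp add: Gr_arith)
  then show ?thesis
    using of_int_gr9[of 3] by simp
qed

text \<open>The Teichmueller lift of the generator \<open>1 + i\<close> of \<open>F9\<close>: \<open>7 (1 + i) = (1 + i) ^ 9\<close>.\<close>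
definition tau :: gr9 where
  "tau = Gr 7 7"

lemma tau_pow4: "tau ^ 4 = -1"
proof -
  have "tau ^ 4 = (tau * tau) * (tau * tau)"
    by (simp add: eval_nat_numeral mult_ac)
  then show ?thesis
    by (simp add: tau_def Gr_arith Gr_1 Gr_eq_iff)
qed

section \<open>Teichmueller characters and Jacobi sums\<close>

lemma tau_pow_mod_8: "(tau ^ k) ^ (n mod 8) = (tau ^ k) ^ n"
  by (rule power_mod_8, rule root8_pow8, rule tau_pow4)

text \<open>The value at 0 is 0 also for \<open>k = 0\<close>, so the eight characters form a basis
  of the functions vanishing at 0, on which \<open>rho\<close> acts by
  \<open>x \<mapsto> f (act g x) - f (act g (0, 0))\<close>.\<close>

definition chi :: "nat \<Rightarrow> f9 \<Rightarrow> gr9" where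
  "chi k x = (if x = (0, 0) then 0 else (tau ^ k) ^ lg x)"

lemma chi_zero [simp]: "chi k (0, 0) = 0"
  by (simp add: chi_def)

lemma chi_pw [simp]: "chi k (pw n) = (tau ^ k) ^ n"
proof -
  have "pw n \<noteq> (0, 0)"
    by (metis pw_in_units9 zero_notin_units9)
  then show ?thesis
    by (simp add: chi_def tau_pow_mod_8)
qed

lemma chi_mult:
  assumes "x \<in> F9" "y \<in> F9"
  shows "chi k (f9_mult x y) = chi k x * chi k y"
proof -
  have "chi k (f9_mult (pw m) (pw n)) = chi k (pw m) * chi k (pw n)" for m n
    by (simp add: pw_mult power_add)
  then show ?thesis
    using assms by (auto simp: F9_eq units9_def f9_mult_commute[of "(0, 0)"])
qed

text \<open>The coefficients of \<open>x \<mapsto> \<chi>\<^sup>k(x + 1) - \<chi>\<^sup>k(1)\<close>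
  in the basis \<open>\<chi>\<^sup>m\<close>. Up to the factor \<open>-1 = 1 / 8\<close> these are Jacobi sums.\<close>
definition jac :: "nat \<Rightarrow> nat \<Rightarrow> gr9" where
  "jac k m = - (\<Sum>l = 0..<8. (chi k (f9_add (1, 0) (pw l)) - 1) * tau ^ (m * (8 - l)))"

lemma jac_expansion: "chi k (f9_add (1, 0) (pw l)) - 1 = (\<Sum>m = 0..<8. jac k m * (tau ^ m) ^ l)"
proof -
  have "(\<Sum>m = 0..<8. jac k m * (tau ^ m) ^ l) = (\<Sum>m = 0..<8. jac k m * tau ^ (m * (l mod 8)))"
    by (simp add: tau_pow_mod_8 power_mult)
  also have "\<dots> = - (\<Sum>j = 0..<8. (chi k (f9_add (1, 0) (pw j)) - 1) *
      (\<Sum>m = 0..<8. tau ^ (m * (8 - j)) * tau ^ (m * (l mod 8))))"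
    unfolding jac_def mult_minus_left sum_negf sum_distrib_left sum_distrib_right
    by (subst sum.swap) (simp add: mult.assoc)
  also have "\<dots> = - (\<Sum>j = 0..<8. (chi k (f9_add (1, 0) (pw j)) - 1) * (if j = l mod 8 then 8 else 0))"
    by (simp add: fourier_inverse[OF tau_pow4])
  also have "\<dots> = chi k (f9_add (1, 0) (pw l)) - 1"
    by (simp add: if_distrib[of "\<lambda>c. _ * c"] eight_gr9 cong: if_cong)
  finally show ?thesis ..
qed

section \<open>Base 3 carries and the divisibility of Jacobi sums\<close>

definition digit_sum :: "nat \<Rightarrow> nat" where
  "digit_sum n = n mod 3 + n div 3"

text \<open>Modulo \<open>3\<close> the character \<open>\<chi>\<^sup>k\<close> is the function \<open>x \<mapsto> x ^ k\<close> for \<open>k > 0\<close>,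
  but \<open>\<chi>\<^sup>0\<close>, which vanishes at \<open>0\<close>, is \<open>x \<mapsto> x ^ 8\<close>.\<close>
definition weight :: "nat \<Rightarrow> nat" where
  "weight k = digit_sum (if k = 0 then 8 else k)"

text \<open>The number of carries when \<open>m\<close> and \<open>k - m\<close> are added modulo \<open>8\<close> in base \<open>3\<close>.\<close>
definition carries :: "nat \<Rightarrow> nat \<Rightarrow> nat" where
  "carries k m = (weight m + digit_sum ((k + 8 - m) mod 8) - weight k) div 2"

text \<open>Each carry trades three units of a digit for one of the next, and modulo 8 the place
  value 9 wraps around to 1, so it lowers the digit sum by 2. Hence neither the subtraction nor the
  division in \<open>carries\<close> truncates.\<close>

lemma carries_eq:
  assumes "k < 8" "m < 8"
  shows "2 * carries k m + weight k = weight m + digit_sum ((k + 8 - m) mod 8)"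
proof -
  have "\<forall>k\<in>set [0..<8]. \<forall>m\<in>set [0..<8].
      2 * carries k m + weight k = weight m + digit_sum ((k + 8 - m) mod 8)"
    by code_simp
  then show ?thesis using assms by simp
qed

text \<open>Integer representatives of the powers of \<open>tau\<close>, which make the 64 Jacobi
  sums computable by evaluation.\<close>

definition tau_pair :: "nat \<Rightarrow> int \<times> int" where
  "tau_pair n = [(1, 0), (7, 7), (0, 8), (7, 2), (8, 0), (2, 2), (0, 1), (2, 7)] ! (n mod 8)"

text \<open>The list holds the Zech logarithms \<open>lg (1 + pw l)\<close>. At \<open>l = 4\<close>
  the sum \<open>1 + pw l\<close> is zero, and the list entry there is a dummy.\<close>

definition jac_term :: "nat \<Rightarrow> nat \<Rightarrow> nat \<Rightarrow> int \<times> int" where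
  "jac_term k m l =
    (let (a, b) = if l = 4 then (0, 0) else tau_pair (k * [4, 7, 3, 5, 0, 2, 1, 6] ! l);
         (c, d) = tau_pair (m * (8 - l))
     in ((a - 1) * c - b * d, (a - 1) * d + b * c))"

definition jac_pair :: "nat \<Rightarrow> nat \<Rightarrow> int \<times> int" where
  "jac_pair k m = (- (\<Sum>l\<leftarrow>[0..<8]. fst (jac_term k m l)), - (\<Sum>l\<leftarrow>[0..<8]. snd (jac_term k m l)))"

lemma tau_pow_eq: "tau ^ n = Gr (fst (tau_pair n)) (snd (tau_pair n))"
proof -
  have step: "tau ^ m = Gr ((7 * a - 7 * b) mod 9) ((7 * a + 7 * b) mod 9)"
    if "tau ^ n = Gr a b" "m = Suc n" for m n a b
    using that by (simp add: tau_def Gr_arith Gr_eq_iff add.commute)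
  have 0: "tau ^ 0 = Gr 1 0"
    by (simp add: Gr_1)
  have 1: "tau ^ 1 = Gr 7 7" using step[OF 0, of 1] by simp
  have 2: "tau ^ 2 = Gr 0 8" using step[OF 1, of 2] by simp
  have 3: "tau ^ 3 = Gr 7 2" using step[OF 2, of 3] by simp
  have 4: "tau ^ 4 = Gr 8 0" using step[OF 3, of 4] by simp
  have 5: "tau ^ 5 = Gr 2 2" using step[OF 4, of 5] by simp
  have 6: "tau ^ 6 = Gr 0 1" using step[OF 5, of 6] by simp
  have 7: "tau ^ 7 = Gr 2 7" using step[OF 6, of 7] by simp
  have "\<forall>i\<in>{0..<8}. tau ^ i = Gr (fst (tau_pair i)) (snd (tau_pair i))"
    unfolding upt8_eq using 0 1 2 3 4 5 6 7 by (simp add: tau_pair_def)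
  then have "tau ^ (n mod 8) = Gr (fst (tau_pair (n mod 8))) (snd (tau_pair (n mod 8)))"
    by simp
  then show ?thesis
    using tau_pow_mod_8[of 1 n] by (simp add: tau_pair_def)
qed

lemma jac_eq: "jac k m = Gr (fst (jac_pair k m)) (snd (jac_pair k m))"
proof -
  have term_eq: "(chi k (f9_add (1, 0) (pw l)) - 1) * tau ^ (m * (8 - l)) = Gr (fst (jac_term k m l)) (snd (jac_term k m l))"
    if "l \<in> {0..<8}" for l
  proof -
    have zech: "\<forall>l\<in>set [0..<8]. f9_add (1, 0) (pw l) = (if l = 4 then (0, 0) else pw ([4, 7, 3, 5, 0, 2, 1, 6] ! l))"
      by code_simp
    show ?thesis
      using that bspec[OF zech, of l]
      by (simp add: jac_term_def split_def Let_def Gr_0 Gr_1 Gr_arith tau_pow_eq[of "m * (8 - l)"] tau_pow_eq[of "k * n" for n, unfolded power_mult])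
  qed
  show ?thesis
    by (simp add: jac_def jac_pair_def term_eq Gr_sum Gr_arith interv_sum_list_conv_sum_set_nat)
qed

text \<open>The divisibility is verified by evaluating every sum. From two carries on it demands
  that the sum be zero, because \<open>9 = 0\<close>.\<close>

lemma jac_check:
  assumes "k < 8" "m < 8"
  shows "jac k k = 1" and "3 ^ carries k m dvd jac k m"
proof -
  have "\<forall>k\<in>set [0..<8]. fst (jac_pair k k) mod 9 = 1 \<and> snd (jac_pair k k) mod 9 = 0"
    by code_simp
  then show "jac k k = 1"
    using assms by (simp add: jac_eq Gr_1 Gr_eq_iff)
  have check: "\<forall>k\<in>set [0..<8]. \<forall>m\<in>set [0..<8]. (case jac_pair k m of (a, b) \<Rightarrow>
      carries k m = 0 \<or> carries k m = 1 \<and> a mod 3 = 0 \<and> b mod 3 = 0 \<or> a mod 9 = 0 \<and> b mod 9 = 0)"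
    by code_simp
  consider "carries k m = 0"
    | "carries k m = 1" "3 dvd fst (jac_pair k m)" "3 dvd snd (jac_pair k m)"
    | "fst (jac_pair k m) mod 9 = 0" "snd (jac_pair k m) mod 9 = 0"
    using bspec[OF bspec[OF check, of k], of m] assms
    by (auto simp: split_def dvd_eq_mod_eq_0)
  then show "3 ^ carries k m dvd jac k m"
  proof cases
    case 3
    then have "jac k m = 0" by (simp add: jac_eq Gr_0 Gr_eq_iff)
    then show ?thesis by simp
  qed (simp_all add: jac_eq three_dvd_Gr)
qed

text \<open>The matrix of \<open>g = (u, b)\<close> on the characters. For \<open>b = 0\<close> it
  is diagonal; otherwise \<open>u x + b = b (1 + u x / b)\<close> reduces it to \<open>jac\<close>,
  with the factors \<open>\<chi>\<^sup>k(b)\<close>, \<open>\<chi>\<^sup>m(1 / b)\<close> and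
  \<open>\<chi>\<^sup>m(u)\<close>.\<close>

definition hat :: "f9 \<times> f9 \<Rightarrow> nat \<Rightarrow> nat \<Rightarrow> gr9" where
  "hat g k m =
    (if snd g = (0, 0) then if k = m then (tau ^ k) ^ lg (fst g) else 0
     else tau ^ (k * lg (snd g)) * tau ^ (m * (8 - lg (snd g))) * (tau ^ m) ^ lg (fst g) * jac k m)"

lemma hat_expansion:
  assumes g: "g \<in> GA19" and k: "k < 8"
  shows "chi k (act g (pw j)) - chi k (act g (0, 0)) = (\<Sum>m = 0..<8. hat g k m * (tau ^ m) ^ j)"
proof -
  obtain u b where ub: "g = (u, b)" "u \<in> set units9" "b \<in> F9"
    using g by (auto simp: GA19_eq)
  have ux: "f9_mult u (pw j) = pw (lg u + j)"
    using ub pw_mult[of "lg u" j] by simp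
  have act0: "act g (0, 0) = b"
    using ub by (simp add: act_def f9_add_zero)
  show ?thesis
  proof (cases "b = (0, 0)")
    case True
    have "chi k (act g (pw j)) = (tau ^ k) ^ (lg u + j)"
      using True pw_in_units9[of "lg u + j"] by (simp add: act_def ub ux f9_add_zero F9_eq)
    moreover have "(\<Sum>m = 0..<8. hat g k m * (tau ^ m) ^ j) = (tau ^ k) ^ lg u * (tau ^ k) ^ j"
      using k by (simp add: hat_def ub True if_distrib[of "\<lambda>c. c * _"] cong: if_cong)
    ultimately show ?thesis
      by (simp add: act0 True power_add)
  next
    case False
    then have b: "b \<in> set units9" using ub by (simp add: F9_eq)
    define l where "l = lg u + j + (8 - lg b)"
    have "f9_mult b (pw l) = f9_mult (pw (lg b)) (pw l)"
      using b by simp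
    also have "\<dots> = pw (lg b + l)"
      by (rule pw_mult)
    also have "lg b + l = lg u + j + 8"
      using lg_less[OF b] by (simp add: l_def)
    also have "pw (lg u + j + 8) = pw (lg u + j)"
      by (metis pw_mod mod_add_self2)
    finally have bl: "f9_mult b (pw l) = pw (lg u + j)" .
    have "f9_mult b (f9_add (1, 0) (pw l)) = f9_add b (pw (lg u + j))"
      using ub by (simp add: f9_distrib bl f9_mult_commute[of _ "(1, 0)"] f9_one_mult)
    also have "\<dots> = act g (pw j)"
      by (simp add: act_def ub ux f9_add_def add.commute)
    finally have "act g (pw j) = f9_mult b (f9_add (1, 0) (pw l))" ..
    then have "chi k (act g (pw j)) - chi k (act g (0, 0)) = chi k b * (chi k (f9_add (1, 0) (pw l)) - 1)"
      using ub(3) by (simp add: act0 chi_mult right_diff_distrib)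
    also have "\<dots> = (\<Sum>m = 0..<8. chi k b * (jac k m * (tau ^ m) ^ l))"
      by (simp add: jac_expansion sum_distrib_left)
    also have "\<dots> = (\<Sum>m = 0..<8. hat g k m * (tau ^ m) ^ j)"
      using False by (simp add: hat_def ub chi_def l_def power_add power_mult mult_ac)
    finally show ?thesis .
  qed
qed

section \<open>Only the diagonal survives modulo 9\<close>

lemma carries_self: "carries k k = 0"
  by (simp add: carries_def digit_sum_def)

lemma hat_dvd:
  assumes "k < 8" "m < 8"
  shows "3 ^ carries k m dvd hat g k m"
  using jac_check(2)[OF assms] by (auto simp: hat_def carries_self)

text \<open>On the diagonal the two powers coming from \<open>b\<close> cancel and
  \<open>jac k k = 1\<close>, so the translation part disappears.\<close>

lemma hat_diag:
  assumes g: "g \<in> GA19" and k: "k < 8"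
  shows "hat g k k = (tau ^ k) ^ lg (fst g)"
proof (cases "snd g = (0, 0)")
  case False
  then have "lg (snd g) < 8"
    using g by (auto simp: GA19_eq F9_eq)
  then have "k * lg (snd g) + k * (8 - lg (snd g)) = k * 8"
    by (simp flip: distrib_left)
  then have "tau ^ (k * lg (snd g)) * tau ^ (k * (8 - lg (snd g))) = (tau ^ k) ^ 8"
    by (simp flip: power_add power_mult)
  then show ?thesis
    using False k by (simp add: hat_def jac_check(1) root8_pow8[OF tau_pow4])
qed (simp add: hat_def)

text \<open>Summed over a permutation the weights cancel, and twice the number \<open>C\<close> of
  carries is the total digit sum of the differences \<open>\<delta> k\<close>. These add up to a
  multiple of 8, positive unless \<open>p = id\<close>. Three times a digit sum bounds the number
  itself, so \<open>6 C \<ge> 8\<close> and \<open>C \<ge> 2\<close>.\<close>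

lemma sum_carries:
  assumes p: "p permutes {0..<8}" and "p \<noteq> id"
  shows "2 \<le> (\<Sum>k = 0..<8. carries k (p k))"
proof -
  define \<delta> where "\<delta> k = (k + 8 - p k) mod 8" for k
  have p8: "p k < 8" if "k < 8" for k
    using permutes_in_image[OF p, of k] that by simp
  have perm: "(\<Sum>k = 0..<8. f (p k)) = sum f {0..<8}" for f :: "nat \<Rightarrow> nat"
    using sum.permute[OF p, of f] by (simp add: comp_def)
  have "(\<Sum>k = 0..<8. 2 * carries k (p k) + weight k) = (\<Sum>k = 0..<8. weight (p k) + digit_sum (\<delta> k))"
    by (intro sum.cong refl) (simp add: carries_eq p8 \<delta>_def)
  then have 1: "2 * (\<Sum>k = 0..<8. carries k (p k)) = (\<Sum>k = 0..<8. \<delta> k mod 3) + (\<Sum>k = 0..<8. \<delta> k div 3)"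
    by (simp add: sum.distrib perm digit_sum_def flip: sum_distrib_left)
  have 2: "(\<Sum>k = 0..<8. \<delta> k) = (\<Sum>k = 0..<8. \<delta> k mod 3) + 3 * (\<Sum>k = 0..<8. \<delta> k div 3)"
    by (simp add: sum_distrib_left flip: sum.distrib)
  have "(\<Sum>k = 0..<8. k + 8 - p k) + (\<Sum>k = 0..<8. p k) = (\<Sum>k = 0..<8. k + 8)"
    unfolding sum.distrib[symmetric] using p8 by (intro sum.cong refl) (simp add: less_imp_le trans_le_add2)
  then have "(\<Sum>k = 0..<8. k + 8 - p k) = 64"
    using perm[of "\<lambda>k. k"] by (simp add: sum.distrib)
  then have "8 dvd (\<Sum>k = 0..<8. \<delta> k)"
    using mod_sum_eq[of "\<lambda>k. k + 8 - p k" 8 "{0..<8}"] by (simp add: \<delta>_def dvd_eq_mod_eq_0)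
  then obtain q where q: "(\<Sum>k = 0..<8. \<delta> k) = 8 * q"
    by (rule dvdE)
  obtain k where "p k \<noteq> k"
    using assms(2) by (auto simp: fun_eq_iff)
  then have k: "k < 8" "p k \<noteq> k"
    using p by (auto simp: permutes_def)
  then have "\<delta> k \<noteq> 0"
    using p8[of k] mod8_shift[of 0 "p k" k] by (simp add: \<delta>_def)
  then have "(\<Sum>k = 0..<8. \<delta> k) \<noteq> 0"
    using k by auto
  then have "q \<ge> 1"
    using q by (cases q) simp_all
  then show ?thesis
    using 1 2 q by linarith
qed

text \<open>In the Leibniz expansion every permutation other than the identity gives a multiple of
  \<open>3 ^ 2 = 0\<close>.\<close>

lemma sdet_carries:
  fixes f :: "nat \<Rightarrow> nat \<Rightarrow> gr9"
  assumes f: "\<And>k m. k < 8 \<Longrightarrow> m < 8 \<Longrightarrow> 3 ^ carries k m dvd f k m"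
  shows "sdet [0..<8] f = (\<Prod>k = 0..<8. f k k)"
proof -
  have p8: "p k < 8" if "p permutes {0..<8}" "k < 8" for p and k :: nat
    using permutes_in_image[OF that(1), of k] that(2) by simp
  have zero: "(\<Prod>k = 0..<8. f k (p k)) = 0" if p: "p permutes {0..<8}" "p \<noteq> id" for p
  proof -
    have "(\<Prod>k = 0..<8. 3 ^ carries k (p k)) dvd (\<Prod>k = 0..<8. f k (p k))"
      by (intro prod_dvd_prod f) (simp_all add: p8[OF p(1)])
    moreover have "(3 :: gr9) ^ 2 dvd (\<Prod>k = 0..<8. 3 ^ carries k (p k))"
      unfolding power_sum[symmetric] by (rule le_imp_power_dvd[OF sum_carries[OF p]])
    moreover have "(3 :: gr9) ^ 2 = 0"
      by (simp add: nine_gr9)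
    ultimately show ?thesis
      by (metis dvd_trans dvd_0_left)
  qed
  have "sdet [0..<8] f = (\<Sum>p | p permutes {0..<8::nat}. signof p * (\<Prod>k = 0..<8. f k (p k)))"
    unfolding sdet_def by (subst det_def') (auto intro!: sum.cong prod.cong simp: p8)
  also have "\<dots> = (\<Sum>p | p permutes {0..<8::nat}. if p = id then \<Prod>k = 0..<8. f k k else 0)"
    using zero by (intro sum.cong) auto
  also have "\<dots> = (\<Prod>k = 0..<8. f k k)"
    by (simp add: finite_permutations permutes_id)
  finally show ?thesis .
qed

lemma sum_chi_rho:
  "(\<Sum>y\<in>set units9. chi k y * of_int (rho g y x)) = chi k (act g x) - chi k (act g (0, 0))"
proof -
  have "(\<Sum>y\<in>set units9. chi k y * of_int (rho g y x)) = (\<Sum>y\<in>F9. chi k y * of_int (rho g y x))"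
    by (rule sum_units9) simp
  also have "\<dots> = chi k (act g x) - chi k (act g (0, 0))"
    by (simp add: rho_def right_diff_distrib sum_subtractf of_bool_def if_distrib[of "\<lambda>c. _ * c"]
        if_distrib[of of_int] cong: if_cong)
  finally show ?thesis .
qed

text \<open>Changing to the basis of characters costs \<open>8 ^ 8 = 1\<close>. The diagonal entries
  there are the character values of \<open>quot_coeff a\<close>, whose product is the circulant
  determinant by \<open>fourier_circ\<close> over the same ring.\<close>

theorem det_rho_mat_cong:
  "[sdet units9 (rho_mat a) = sdet [0..<8] (circ (quot_coeff a))] (mod 9)"
proof -
  define h where "h k m = (\<Sum>g\<in>GA19. of_int (a g) * hat g k m)" for k m
  have 8: "(8 :: gr9) ^ 8 = 1"
    by (simp add: eight_gr9)
  have "8 ^ length units9 * sdet units9 (\<lambda>y x. of_int (rho_mat a y x)) = (8 :: gr9) ^ length units9 * sdet [0..<8] h"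
  proof (rule sdet_intertwine[where W = chi and V = "\<lambda>y k. tau ^ (k * (8 - lg y))"])
    fix k x assume "k \<in> set [0..<8]" and x: "x \<in> set units9"
    then have k: "k < 8" by simp
    have exp: "chi k (act g x) - chi k (act g (0, 0)) = (\<Sum>m = 0..<8. hat g k m * chi m x)" if "g \<in> GA19" for g
      using hat_expansion[OF that k, of "lg x"] x by (auto simp: units9_def tau_pow_mod_8)
    have "(\<Sum>y\<in>set units9. chi k y * of_int (rho_mat a y x))
        = (\<Sum>g\<in>GA19. of_int (a g) * (\<Sum>y\<in>set units9. chi k y * of_int (rho g y x)))"
      unfolding rho_mat_def of_int_sum of_int_mult sum_distrib_left
      by (subst sum.swap) (simp add: mult_ac)
    also have "\<dots> = (\<Sum>g\<in>GA19. of_int (a g) * (\<Sum>m = 0..<8. hat g k m * chi m x))"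
      by (simp add: sum_chi_rho exp)
    also have "\<dots> = (\<Sum>m\<in>set [0..<8]. h k m * chi m x)"
      unfolding h_def sum_distrib_left sum_distrib_right
      by (subst sum.swap) (simp add: mult_ac)
    finally show "(\<Sum>y\<in>set units9. chi k y * of_int (rho_mat a y x)) = (\<Sum>m\<in>set [0..<8]. h k m * chi m x)" .
  next
    fix y y' assume y: "y \<in> set units9" "y' \<in> set units9"
    then have "(\<Sum>k\<in>set [0..<8]. tau ^ (k * (8 - lg y)) * chi k y')
        = (\<Sum>k = 0..<8. tau ^ (k * (8 - lg y)) * tau ^ (k * lg y'))"
      by (intro sum.cong) (auto simp: chi_def power_mult)
    then show "(\<Sum>k\<in>set [0..<8]. tau ^ (k * (8 - lg y)) * chi k y') = (if y = y' then 8 else 0)"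
      using y by (simp add: fourier_inverse[OF tau_pow4] lg_eq_iff)
  qed simp_all
  then have "of_int (sdet units9 (rho_mat a)) = sdet [0..<8] h"
    by (simp only: of_int_sdet length_units9 8 mult_1_left)
  also have "\<dots> = (\<Prod>k = 0..<8. h k k)"
    by (rule sdet_carries) (auto simp: h_def intro!: dvd_sum dvd_mult hat_dvd)
  also have "\<dots> = (\<Prod>k = 0..<8. \<Sum>j = 0..<8. of_int (quot_coeff a j) * (tau ^ k) ^ j)"
  proof (intro prod.cong refl)
    fix k :: nat assume "k \<in> {0..<8}"
    then have "h k k = (\<Sum>g\<in>GA19. of_int (a g) * (tau ^ k) ^ lg (fst g))"
      by (simp add: h_def hat_diag)
    also have "\<dots> = (\<Sum>g\<in>GA19. of_int (a g) * (\<Sum>j = 0..<8. of_bool (lg (fst g) = j) * (tau ^ k) ^ j))"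
      by (intro sum.cong refl) (auto simp: GA19_eq of_bool_def if_distrib[of "\<lambda>c. c * _"] cong: if_cong)
    also have "\<dots> = (\<Sum>j = 0..<8. of_int (quot_coeff a j) * (tau ^ k) ^ j)"
      unfolding quot_coeff_def of_int_sum of_int_mult sum_distrib_left sum_distrib_right
      by (subst sum.swap) (simp add: mult_ac)
    finally show "h k k = (\<Sum>j = 0..<8. of_int (quot_coeff a j) * (tau ^ k) ^ j)" .
  qed
  also have "\<dots> = of_int (sdet [0..<8] (circ (quot_coeff a)))"
  proof -
    have "of_int (sdet [0..<8] (circ (quot_coeff a))) = sdet [0..<8] (circ (\<lambda>j. of_int (quot_coeff a j) :: gr9))"
      by (auto simp: of_int_sdet circ_def intro!: sdet_cong)
    then show ?thesis
      using fourier_circ[OF tau_pow4, of "\<lambda>j. of_int (quot_coeff a j)"] by (simp only: 8 mult_1_left)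
  qed
  finally show ?thesis
    by (simp add: of_int_gr9_eq_iff cong_def)
qed

section \<open>Elements with prescribed determinants\<close>

text \<open>A table \<open>xs\<close> stands for the group ring element \<open>\<Sum>(h, v)\<leftarrow>xs. v h\<close>.\<close>
definition table_sum :: "((f9 \<times> f9) \<times> int) list \<Rightarrow> (f9 \<times> f9 \<Rightarrow> int) \<Rightarrow> int" where
  "table_sum xs F = (\<Sum>p\<leftarrow>xs. snd p * F (fst p))"

definition table_coeff :: "((f9 \<times> f9) \<times> int) list \<Rightarrow> nat \<Rightarrow> int" where
  "table_coeff xs c = table_sum xs (\<lambda>h. of_bool (lg (fst h) = c))"

definition table_mat :: "((f9 \<times> f9) \<times> int) list \<Rightarrow> f9 \<Rightarrow> f9 \<Rightarrow> int" where
  "table_mat xs y x = table_sum xs (\<lambda>h. rho h y x)"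

text \<open>The coefficients of \<open>\<Sum>(h, v)\<leftarrow>xs. v h + j s + k (1 - n) s\<close>, where \<open>s\<close> is the sum of the
  complement \<open>b = 0\<close> and \<open>n = (1, 1)\<close> is a translation.\<close>
definition family :: "((f9 \<times> f9) \<times> int) list \<Rightarrow> int \<Rightarrow> int \<Rightarrow> f9 \<times> f9 \<Rightarrow> int" where
  "family xs j k g = table_sum xs (\<lambda>h. of_bool (g = h))
     + ((j + k) * of_bool (snd g = (0, 0)) - k * of_bool (snd g = (1, 0)))"

lemma sum_table:
  assumes "fst ` set xs \<subseteq> GA19"
  shows "(\<Sum>g\<in>GA19. table_sum xs (\<lambda>h. of_bool (g = h)) * F g) = table_sum xs F"
  using assms
proof (induction xs)
  case Nil
  then show ?case by (simp add: table_sum_def)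
next
  case (Cons p xs)
  have "(\<Sum>g\<in>GA19. snd p * of_bool (g = fst p) * F g) = snd p * F (fst p)"
    using Cons.prems by (simp add: of_bool_def if_distrib[of "\<lambda>c. c * _"] if_distrib[of "\<lambda>c. _ * c"] cong: if_cong)
  then show ?case
    using Cons by (simp add: table_sum_def distrib_right sum.distrib)
qed

lemma sum_family:
  assumes "fst ` set xs \<subseteq> GA19"
  shows "(\<Sum>g\<in>GA19. family xs j k g * F g) = table_sum xs F
     + (j + k) * (\<Sum>u\<in>set units9. F (u, (0, 0))) - k * (\<Sum>u\<in>set units9. F (u, (1, 0)))"
proof -
  have fib: "(\<Sum>g\<in>GA19. of_bool (snd g = b) * F g) = (\<Sum>u\<in>set units9. F (u, b))" if "b \<in> F9" for b
  proof -
    have "(\<Sum>g\<in>GA19. of_bool (snd g = b) * F g) = (\<Sum>u\<in>set units9. \<Sum>b'\<in>F9. of_bool (b' = b) * F (u, b'))"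
      unfolding GA19_eq sum.cartesian_product' by (simp only: snd_conv)
    then show ?thesis
      using that by (simp add: of_bool_def if_distrib[of "\<lambda>c. c * _"] cong: if_cong)
  qed
  have "(\<Sum>g\<in>GA19. family xs j k g * F g) = (\<Sum>g\<in>GA19. table_sum xs (\<lambda>h. of_bool (g = h)) * F g)
      + (j + k) * (\<Sum>g\<in>GA19. of_bool (snd g = (0, 0)) * F g) - k * (\<Sum>g\<in>GA19. of_bool (snd g = (1, 0)) * F g)"
    unfolding sum_distrib_left sum.distrib[symmetric] sum_subtractf[symmetric]
    by (intro sum.cong refl) (simp only: family_def, simp only: algebra_simps)
  moreover have "(0, 0) \<in> F9" "(1, 0) \<in> F9"
    by (simp_all add: F9_def)
  ultimately show ?thesis
    by (simp only: sum_table[OF assms] fib)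
qed

text \<open>In the quotient \<open>C8\<close> the element \<open>s\<close> becomes the sum of all
  elements and \<open>(1 - n) s\<close> becomes zero.\<close>

lemma quot_coeff_family:
  assumes "fst ` set xs \<subseteq> GA19" "c < 8"
  shows "quot_coeff (family xs j k) c = table_coeff xs c + j"
proof -
  have "(\<Sum>u\<in>set units9. of_bool (lg u = c)) = (\<Sum>u\<in>set units9. of_bool (u = pw c) :: int)"
    using assms(2) by (intro sum.cong) (auto simp: units9_def)
  also have "\<dots> = 1"
    by (simp add: of_bool_def)
  finally have "(\<Sum>u\<in>set units9. of_bool (lg u = c)) = (1 :: int)" .
  then show ?thesis
    using sum_family[OF assms(1), of j k "\<lambda>g. of_bool (lg (fst g) = c)"]
    by (simp add: quot_coeff_def table_coeff_def)
qed

text \<open>For nonzero \<open>x\<close> and varying \<open>u\<close>, the point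
  \<open>u x + b\<close> takes every value except \<open>b\<close> once, while the origin goes to
  \<open>b\<close> eight times. Hence the column \<open>1 - 9 * of_bool (y = b)\<close>, the same
  for every \<open>x\<close>, which makes the perturbation one of rank one.\<close>

lemma rho_mat_family:
  assumes "fst ` set xs \<subseteq> GA19" "y \<in> set units9" "x \<in> set units9"
  shows "rho_mat (family xs j k) y x = table_mat xs y x + (j + 9 * k * of_bool (y = (1, 0)))"
proof -
  have "\<forall>b\<in>set [(0, 0), (1, 0)]. \<forall>y\<in>set units9. \<forall>x\<in>set units9.
      (\<Sum>u\<leftarrow>units9. rho (u, b) y x) = 1 - 9 * of_bool (y = b)"
    by code_simp
  then have fib: "(\<Sum>u\<in>set units9. rho (u, b) y x) = 1 - 9 * of_bool (y = b)" if "b \<in> set [(0, 0), (1, 0)]" for b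
    using that assms by (simp only: sum_list_distinct_conv_sum_set[OF distinct_units9])
  have "y \<noteq> (0, 0)"
    using assms by (metis zero_notin_units9)
  then show ?thesis
    using sum_family[OF assms(1), of j k "\<lambda>g. rho g y x"] fib[of "(0, 0)"] fib[of "(1, 0)"]
    by (simp add: rho_mat_def table_mat_def algebra_simps)
qed

lemma circ_col_sum:
  assumes "j < 8"
  shows "(\<Sum>i = 0..<8. circ c i j) = (\<Sum>i = 0..<8. c i)"
proof (rule sum.reindex_bij_witness[of _ "\<lambda>m. (m + j) mod 8" "\<lambda>i. (i + 8 - j) mod 8"])
  fix i :: nat assume "i \<in> {0..<8}"
  then show "((i + 8 - j) mod 8 + j) mod 8 = i"
    using mod8_shift[of "(i + 8 - j) mod 8" j i] assms by simp
next
  fix m :: nat assume "m \<in> {0..<8}"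
  then show "((m + j) mod 8 + 8 - j) mod 8 = m"
    using mod8_shift[of m j "(m + j) mod 8"] assms by simp
qed (auto simp: circ_def)

text \<open>\<open>P\<close> and \<open>s\<close> are what remains of the two determinants after
  removing the eigenvalue \<open>e\<close> of the row of ones. The perturbation moves this
  eigenvalue to \<open>e + 8 * j\<close> and \<open>e + 8 * j + 9 * k\<close> respectively and
  leaves \<open>P\<close> and \<open>s\<close> alone.\<close>

lemma realize:
  assumes xs: "fst ` set xs \<subseteq> GA19"
    and circ: "sdet [0..<8] (circ (table_coeff xs)) = P * e"
    and coeff_sum: "(\<Sum>i = 0..<8. table_coeff xs i) = e"
    and det: "sdet units9 (table_mat xs) = s * e"
    and col_sum: "\<And>x. x \<in> set units9 \<Longrightarrow> (\<Sum>y\<in>set units9. table_mat xs y x) = e"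
    and e: "e \<noteq> 0"
  shows "P * (e + 8 * j) * (s * (e + 8 * j + 9 * k)) ^ 8 \<in> int_group_dets GA19 ga_mult ga_inv"
proof -
  have "sdet [0..<8] (circ (quot_coeff (family xs j k))) = sdet [0..<8] (\<lambda>i i'. circ (table_coeff xs) i i' + j)"
    by (rule sdet_cong) (simp add: circ_def quot_coeff_family[OF xs])
  moreover have "e * sdet [0..<8] (\<lambda>i i'. circ (table_coeff xs) i i' + j)
      = (e + (\<Sum>i\<in>set [0..<8::nat]. j)) * sdet [0..<8] (circ (table_coeff xs))"
    by (rule sdet_rank_one_update) (auto simp: circ_col_sum coeff_sum)
  ultimately have A: "sdet [0..<8] (circ (quot_coeff (family xs j k))) = P * (e + 8 * j)"
    using e by (simp add: circ)
  have "sdet units9 (rho_mat (family xs j k))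
      = sdet units9 (\<lambda>y x. table_mat xs y x + (j + 9 * k * of_bool (y = (1, 0))))"
    by (rule sdet_cong) (simp add: rho_mat_family[OF xs])
  moreover have "e * sdet units9 (\<lambda>y x. table_mat xs y x + (j + 9 * k * of_bool (y = (1, 0))))
      = (e + (\<Sum>y\<in>set units9. j + 9 * k * of_bool (y = (1, 0)))) * sdet units9 (table_mat xs)"
    using length_units9 by (intro sdet_rank_one_update) (auto simp: col_sum simp del: length_units9)
  moreover have "(\<Sum>y\<in>set units9. j + 9 * k * of_bool (y = (1, 0))) = 8 * j + 9 * k"
    by (simp add: units9_eq)
  ultimately have B: "sdet units9 (rho_mat (family xs j k)) = s * (e + 8 * j + 9 * k)"
    using e by (simp add: det)
  have "P * (e + 8 * j) * (s * (e + 8 * j + 9 * k)) ^ 8 = group_det GA19 ga_mult ga_inv (family xs j k)"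
    by (simp add: group_det_GA19 A B)
  then show ?thesis
    unfolding int_group_dets_def by blast
qed

section \<open>Determinant certificates for explicit tables\<close>

lemma map_upt8_eqD:
  assumes "map f [0..<8] = [a0, a1, a2, a3, a4, a5, a6, a7]"
  shows "f 0 = a0" "f 1 = a1" "f 2 = a2" "f 3 = a3" "f 4 = a4" "f 5 = a5" "f 6 = a6" "f 7 = a7"
  using assms by (simp_all add: upt_rec numeral_eq_Suc)

text \<open>A certificate \<open>L M = U\<close> with triangular \<open>L\<close> and
  \<open>U\<close>. The diagonal of \<open>L\<close> may differ from 1, so that elimination stays
  within the integers.\<close>

definition lu_check :: "int list list \<Rightarrow> int list list \<Rightarrow> int list list \<Rightarrow> bool" where
  "lu_check L M U \<longleftrightarrow> (\<forall>i\<in>set [0..<8]. \<forall>j\<in>set [0..<8].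
     (\<Sum>k\<leftarrow>[0..<8]. L ! i ! k * M ! k ! j) = U ! i ! j \<and>
     (i < j \<longrightarrow> L ! i ! j = 0) \<and> (j < i \<longrightarrow> U ! i ! j = 0))"

lemma table_mat_nth:
  assumes "map (\<lambda>i. map (\<lambda>j. table_mat xs (pw i) (pw j)) [0..<8]) [0..<8] = M" "i < 8" "j < 8"
  shows "table_mat xs (pw i) (pw j) = M ! i ! j"
  using assms by (auto simp: nth_map)

lemma sdet_LU:
  assumes M: "map (\<lambda>i. map (\<lambda>j. table_mat xs (pw i) (pw j)) [0..<8]) [0..<8] = M"
    and lu: "lu_check L M U"
  shows "(\<Prod>i = 0..<8. L ! i ! i) * sdet units9 (table_mat xs) = (\<Prod>i = 0..<8. U ! i ! i)"
proof -
  have chk: "(\<Sum>k = 0..<8. L ! i ! k * M ! k ! j) = U ! i ! j"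
      "i < j \<Longrightarrow> L ! i ! j = 0" "j < i \<Longrightarrow> U ! i ! j = 0" if "i < 8" "j < 8" for i j
    using lu that unfolding lu_check_def by (auto simp: interv_sum_list_conv_sum_set_nat)
  have "sdet units9 (table_mat xs) = sdet [0..<8] (\<lambda>i j. M ! i ! j)"
    unfolding units9_def sdet_map by (rule sdet_cong) (simp add: table_mat_nth[OF M])
  moreover have "sdet [0..<8] (\<lambda>i j. L ! i ! j) * sdet [0..<8] (\<lambda>i j. M ! i ! j) = sdet [0..<8] (\<lambda>i j. U ! i ! j)"
    by (subst sdet_mult_distinct) (auto intro!: sdet_cong simp: chk(1))
  moreover have "sdet [0..<8] (\<lambda>i j. L ! i ! j) = sdet [0..<8] (\<lambda>i j. L ! j ! i)"
    by (rule sdet_transpose[symmetric])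
  moreover have "sdet [0..<8] (\<lambda>i j. L ! j ! i) = (\<Prod>i = 0..<8. L ! i ! i)"
    by (rule sdet_upper_triangular) (simp add: chk(2))
  moreover have "sdet [0..<8] (\<lambda>i j. U ! i ! j) = (\<Prod>i = 0..<8. U ! i ! i)"
    by (rule sdet_upper_triangular) (simp add: chk(3))
  ultimately show ?thesis by simp
qed

lemma table_mat_col_sum:
  assumes M: "map (\<lambda>i. map (\<lambda>j. table_mat xs (pw i) (pw j)) [0..<8]) [0..<8] = M"
    and sums: "map (\<lambda>j. \<Sum>i\<leftarrow>[0..<8]. M ! i ! j) [0..<8] = replicate 8 e"
    and x: "x \<in> set units9"
  shows "(\<Sum>y\<in>set units9. table_mat xs y x) = e"
proof -
  obtain j where j: "j < 8" "x = pw j"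
    using x by (auto simp: units9_def)
  have "(\<Sum>y\<leftarrow>units9. table_mat xs y x) = (\<Sum>i\<leftarrow>[0..<8]. M ! i ! j)"
    unfolding units9_def map_map comp_def using j
    by (intro arg_cong[where f = sum_list] map_cong) (simp_all add: table_mat_nth[OF M])
  also have "\<dots> = e"
    using arg_cong[OF sums, of "\<lambda>l. l ! j"] j(1) by simp
  finally show ?thesis
    by (simp add: sum_list_distinct_conv_sum_set)
qed


text \<open>For odd \<open>A\<close> the base elements are the units \<open>1 + \<dots> + x ^ (e - 1)\<close> of \<open>\<int>[C\<^sub>8]\<close> modulo the sum of
  all elements of \<open>C\<^sub>8\<close>.\<close>
lemma realize_table_1:
  "1 * (1 + 8 * j) * (1 * (1 + 8 * j + 9 * k)) ^ 8 \<in> int_group_dets GA19 ga_mult ga_inv"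
proof (rule realize)
  let ?xs = "map (\<lambda>i. ((pw i, (0, 0)), 1)) [0..<1] :: ((f9 \<times> f9) \<times> int) list"
  show "fst ` set ?xs \<subseteq> GA19"
    by (auto simp: GA19_eq F9_def)
  have c: "map (table_coeff ?xs) [0..<8] = [1, 0, 0, 0, 0, 0, 0, 0]"
    by code_simp
  show "sdet [0..<8] (circ (table_coeff ?xs)) = 1 * 1"
    unfolding det_circ using map_upt8_eqD[OF c] by simp
  show "(\<Sum>i = 0..<8. table_coeff ?xs i) = 1"
    using map_upt8_eqD[OF c] by (simp add: sum_upt8)
  let ?M = "[[1, 0, 0, 0, 0, 0, 0, 0],
            [0, 1, 0, 0, 0, 0, 0, 0],
            [0, 0, 1, 0, 0, 0, 0, 0],
            [0, 0, 0, 1, 0, 0, 0, 0],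
            [0, 0, 0, 0, 1, 0, 0, 0],
            [0, 0, 0, 0, 0, 1, 0, 0],
            [0, 0, 0, 0, 0, 0, 1, 0],
            [0, 0, 0, 0, 0, 0, 0, 1]] :: int list list"
  let ?L = "[[1, 0, 0, 0, 0, 0, 0, 0],
            [0, 1, 0, 0, 0, 0, 0, 0],
            [0, 0, 1, 0, 0, 0, 0, 0],
            [0, 0, 0, 1, 0, 0, 0, 0],
            [0, 0, 0, 0, 1, 0, 0, 0],
            [0, 0, 0, 0, 0, 1, 0, 0],
            [0, 0, 0, 0, 0, 0, 1, 0],
            [0, 0, 0, 0, 0, 0, 0, 1]] :: int list list"
  let ?U = "[[1, 0, 0, 0, 0, 0, 0, 0],
            [0, 1, 0, 0, 0, 0, 0, 0],
            [0, 0, 1, 0, 0, 0, 0, 0],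
            [0, 0, 0, 1, 0, 0, 0, 0],
            [0, 0, 0, 0, 1, 0, 0, 0],
            [0, 0, 0, 0, 0, 1, 0, 0],
            [0, 0, 0, 0, 0, 0, 1, 0],
            [0, 0, 0, 0, 0, 0, 0, 1]] :: int list list"
  have M: "map (\<lambda>i. map (\<lambda>j. table_mat ?xs (pw i) (pw j)) [0..<8]) [0..<8] = ?M"
    by code_simp
  have "lu_check ?L ?M ?U"
    by code_simp
  from sdet_LU[OF M this] show "sdet units9 (table_mat ?xs) = 1 * 1"
    by (simp add: prod_upt8)
  have "map (\<lambda>j. \<Sum>i\<leftarrow>[0..<8]. ?M ! i ! j) [0..<8] = replicate 8 1"
    by code_simp
  from table_mat_col_sum[OF M this] show "\<And>x. x \<in> set units9 \<Longrightarrow> (\<Sum>y\<in>set units9. table_mat ?xs y x) = 1" .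
qed simp

lemma realize_table_3:
  "1 * (3 + 8 * j) * (1 * (3 + 8 * j + 9 * k)) ^ 8 \<in> int_group_dets GA19 ga_mult ga_inv"
proof (rule realize)
  let ?xs = "map (\<lambda>i. ((pw i, (0, 0)), 1)) [0..<3] :: ((f9 \<times> f9) \<times> int) list"
  show "fst ` set ?xs \<subseteq> GA19"
    by (auto simp: GA19_eq F9_def)
  have c: "map (table_coeff ?xs) [0..<8] = [1, 1, 1, 0, 0, 0, 0, 0]"
    by code_simp
  show "sdet [0..<8] (circ (table_coeff ?xs)) = 1 * 3"
    unfolding det_circ using map_upt8_eqD[OF c] by simp
  show "(\<Sum>i = 0..<8. table_coeff ?xs i) = 3"
    using map_upt8_eqD[OF c] by (simp add: sum_upt8)
  let ?M = "[[1, 0, 0, 0, 0, 0, 1, 1],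
            [1, 1, 0, 0, 0, 0, 0, 1],
            [1, 1, 1, 0, 0, 0, 0, 0],
            [0, 1, 1, 1, 0, 0, 0, 0],
            [0, 0, 1, 1, 1, 0, 0, 0],
            [0, 0, 0, 1, 1, 1, 0, 0],
            [0, 0, 0, 0, 1, 1, 1, 0],
            [0, 0, 0, 0, 0, 1, 1, 1]] :: int list list"
  let ?L = "[[1, 0, 0, 0, 0, 0, 0, 0],
            [-1, 1, 0, 0, 0, 0, 0, 0],
            [0, -1, 1, 0, 0, 0, 0, 0],
            [1, 0, -1, 1, 0, 0, 0, 0],
            [-1, 1, 0, -1, 1, 0, 0, 0],
            [0, -1, 1, 0, -1, 1, 0, 0],
            [1, 0, -1, 1, 0, -1, 1, 0],
            [-1, 2, -1, -1, 2, -1, -1, 2]] :: int list list"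
  let ?U = "[[1, 0, 0, 0, 0, 0, 1, 1],
            [0, 1, 0, 0, 0, 0, -1, 0],
            [0, 0, 1, 0, 0, 0, 0, -1],
            [0, 0, 0, 1, 0, 0, 1, 1],
            [0, 0, 0, 0, 1, 0, -1, 0],
            [0, 0, 0, 0, 0, 1, 0, -1],
            [0, 0, 0, 0, 0, 0, 2, 1],
            [0, 0, 0, 0, 0, 0, 0, 3]] :: int list list"
  have M: "map (\<lambda>i. map (\<lambda>j. table_mat ?xs (pw i) (pw j)) [0..<8]) [0..<8] = ?M"
    by code_simp
  have "lu_check ?L ?M ?U"
    by code_simp
  from sdet_LU[OF M this] show "sdet units9 (table_mat ?xs) = 1 * 3"
    by (simp add: prod_upt8)
  have "map (\<lambda>j. \<Sum>i\<leftarrow>[0..<8]. ?M ! i ! j) [0..<8] = replicate 8 3"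
    by code_simp
  from table_mat_col_sum[OF M this] show "\<And>x. x \<in> set units9 \<Longrightarrow> (\<Sum>y\<in>set units9. table_mat ?xs y x) = 3" .
qed simp

lemma realize_table_5:
  "1 * (5 + 8 * j) * (1 * (5 + 8 * j + 9 * k)) ^ 8 \<in> int_group_dets GA19 ga_mult ga_inv"
proof (rule realize)
  let ?xs = "map (\<lambda>i. ((pw i, (0, 0)), 1)) [0..<5] :: ((f9 \<times> f9) \<times> int) list"
  show "fst ` set ?xs \<subseteq> GA19"
    by (auto simp: GA19_eq F9_def)
  have c: "map (table_coeff ?xs) [0..<8] = [1, 1, 1, 1, 1, 0, 0, 0]"
    by code_simp
  show "sdet [0..<8] (circ (table_coeff ?xs)) = 1 * 5"
    unfolding det_circ using map_upt8_eqD[OF c] by simp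
  show "(\<Sum>i = 0..<8. table_coeff ?xs i) = 5"
    using map_upt8_eqD[OF c] by (simp add: sum_upt8)
  let ?M = "[[1, 0, 0, 0, 1, 1, 1, 1],
            [1, 1, 0, 0, 0, 1, 1, 1],
            [1, 1, 1, 0, 0, 0, 1, 1],
            [1, 1, 1, 1, 0, 0, 0, 1],
            [1, 1, 1, 1, 1, 0, 0, 0],
            [0, 1, 1, 1, 1, 1, 0, 0],
            [0, 0, 1, 1, 1, 1, 1, 0],
            [0, 0, 0, 1, 1, 1, 1, 1]] :: int list list"
  let ?L = "[[1, 0, 0, 0, 0, 0, 0, 0],
            [-1, 1, 0, 0, 0, 0, 0, 0],
            [0, -1, 1, 0, 0, 0, 0, 0],
            [0, 0, -1, 1, 0, 0, 0, 0],
            [0, 0, 0, -1, 1, 0, 0, 0],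
            [1, 0, 0, 1, -2, 1, 0, 0],
            [-1, 1, 0, -1, 1, -1, 1, 0],
            [2, -3, 2, 2, -3, 2, -3, 2]] :: int list list"
  let ?U = "[[1, 0, 0, 0, 1, 1, 1, 1],
            [0, 1, 0, 0, -1, 0, 0, 0],
            [0, 0, 1, 0, 0, -1, 0, 0],
            [0, 0, 0, 1, 0, 0, -1, 0],
            [0, 0, 0, 0, 1, 0, 0, -1],
            [0, 0, 0, 0, 0, 2, 1, 2],
            [0, 0, 0, 0, 0, 0, 1, -1],
            [0, 0, 0, 0, 0, 0, 0, 5]] :: int list list"
  have M: "map (\<lambda>i. map (\<lambda>j. table_mat ?xs (pw i) (pw j)) [0..<8]) [0..<8] = ?M"
    by code_simp
  have "lu_check ?L ?M ?U"
    by code_simp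
  from sdet_LU[OF M this] show "sdet units9 (table_mat ?xs) = 1 * 5"
    by (simp add: prod_upt8)
  have "map (\<lambda>j. \<Sum>i\<leftarrow>[0..<8]. ?M ! i ! j) [0..<8] = replicate 8 5"
    by code_simp
  from table_mat_col_sum[OF M this] show "\<And>x. x \<in> set units9 \<Longrightarrow> (\<Sum>y\<in>set units9. table_mat ?xs y x) = 5" .
qed simp

lemma realize_table_7:
  "1 * (7 + 8 * j) * (1 * (7 + 8 * j + 9 * k)) ^ 8 \<in> int_group_dets GA19 ga_mult ga_inv"
proof (rule realize)
  let ?xs = "map (\<lambda>i. ((pw i, (0, 0)), 1)) [0..<7] :: ((f9 \<times> f9) \<times> int) list"
  show "fst ` set ?xs \<subseteq> GA19"
    by (auto simp: GA19_eq F9_def)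
  have c: "map (table_coeff ?xs) [0..<8] = [1, 1, 1, 1, 1, 1, 1, 0]"
    by code_simp
  show "sdet [0..<8] (circ (table_coeff ?xs)) = 1 * 7"
    unfolding det_circ using map_upt8_eqD[OF c] by simp
  show "(\<Sum>i = 0..<8. table_coeff ?xs i) = 7"
    using map_upt8_eqD[OF c] by (simp add: sum_upt8)
  let ?M = "[[1, 0, 1, 1, 1, 1, 1, 1],
            [1, 1, 0, 1, 1, 1, 1, 1],
            [1, 1, 1, 0, 1, 1, 1, 1],
            [1, 1, 1, 1, 0, 1, 1, 1],
            [1, 1, 1, 1, 1, 0, 1, 1],
            [1, 1, 1, 1, 1, 1, 0, 1],
            [1, 1, 1, 1, 1, 1, 1, 0],
            [0, 1, 1, 1, 1, 1, 1, 1]] :: int list list"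
  let ?L = "[[1, 0, 0, 0, 0, 0, 0, 0],
            [-1, 1, 0, 0, 0, 0, 0, 0],
            [0, -1, 1, 0, 0, 0, 0, 0],
            [0, 0, -1, 1, 0, 0, 0, 0],
            [0, 0, 0, -1, 1, 0, 0, 0],
            [0, 0, 0, 0, -1, 1, 0, 0],
            [0, 0, 0, 0, 0, -1, 1, 0],
            [1, 1, 1, 1, 1, 1, -6, 1]] :: int list list"
  let ?U = "[[1, 0, 1, 1, 1, 1, 1, 1],
            [0, 1, -1, 0, 0, 0, 0, 0],
            [0, 0, 1, -1, 0, 0, 0, 0],
            [0, 0, 0, 1, -1, 0, 0, 0],
            [0, 0, 0, 0, 1, -1, 0, 0],
            [0, 0, 0, 0, 0, 1, -1, 0],
            [0, 0, 0, 0, 0, 0, 1, -1],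
            [0, 0, 0, 0, 0, 0, 0, 7]] :: int list list"
  have M: "map (\<lambda>i. map (\<lambda>j. table_mat ?xs (pw i) (pw j)) [0..<8]) [0..<8] = ?M"
    by code_simp
  have "lu_check ?L ?M ?U"
    by code_simp
  from sdet_LU[OF M this] show "sdet units9 (table_mat ?xs) = 1 * 7"
    by (simp add: prod_upt8)
  have "map (\<lambda>j. \<Sum>i\<leftarrow>[0..<8]. ?M ! i ! j) [0..<8] = replicate 8 7"
    by code_simp
  from table_mat_col_sum[OF M this] show "\<And>x. x \<in> set units9 \<Longrightarrow> (\<Sum>y\<in>set units9. table_mat ?xs y x) = 7" .
qed simp

text \<open>The next two base elements were found by computer search: the nontrivial characters of \<open>C\<^sub>8\<close>
  contribute \<open>P = \<plusminus> 8\<close> to \<open>A\<close>, whereas the sublattice modulo the eigenvector only contributes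
  \<open>\<minusplus> 1\<close> to \<open>B\<close>.\<close>
lemma realize_table_4:
  "8 * (4 + 8 * j) * (-1 * (4 + 8 * j + 9 * k)) ^ 8 \<in> int_group_dets GA19 ga_mult ga_inv"
proof (rule realize)
  let ?xs = "[((pw 0, (0, 0)), 1), ((pw 2, (0, 0)), 1), ((pw 3, (0, 2)), 1), ((pw 4, (0, 0)), 1), ((pw 6, (0, 0)), 1), ((pw 6, (2, 2)), -1)] :: ((f9 \<times> f9) \<times> int) list"
  show "fst ` set ?xs \<subseteq> GA19"
    by (auto simp: GA19_eq F9_def)
  \<comment> \<open>The two terms over \<open>pw 6\<close> have opposite signs and cancel in the
    quotient.\<close>
  have c: "map (table_coeff ?xs) [0..<8] = [1, 0, 1, 1, 1, 0, 0, 0]"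
    by code_simp
  show "sdet [0..<8] (circ (table_coeff ?xs)) = 8 * 4"
    unfolding det_circ using map_upt8_eqD[OF c] by simp
  show "(\<Sum>i = 0..<8. table_coeff ?xs i) = 4"
    using map_upt8_eqD[OF c] by (simp add: sum_upt8)
  let ?M = "[[1, -1, 1, 0, 1, 0, 2, 0],
            [1, 1, 0, 1, 0, 1, 0, 0],
            [0, -1, -1, -1, 0, -1, 0, -1],
            [0, 1, 0, 1, 0, 2, -1, 1],
            [0, 0, 1, 0, 2, 0, 1, 0],
            [1, 3, 1, 2, 1, 2, 1, 2],
            [1, 0, 1, 0, 1, -1, 1, 1],
            [0, 1, 1, 1, -1, 1, 0, 1]] :: int list list"
  let ?L = "[[1, 0, 0, 0, 0, 0, 0, 0],
            [-1, 1, 0, 0, 0, 0, 0, 0],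
            [-1, 1, 2, 0, 0, 0, 0, 0],
            [1, -1, 1, 3, 0, 0, 0, 0],
            [0, 0, 1, 1, 1, 0, 0, 0],
            [1, -2, 1, 1, -1, 1, 0, 0],
            [-1, 0, 0, 2, 0, -1, 2, 0],
            [-1, 3, 3, -1, 3, -1, -1, 3]] :: int list list"
  let ?U = "[[1, -1, 1, 0, 1, 0, 2, 0],
            [0, 2, -1, 1, -1, 1, -2, 0],
            [0, 0, -3, -1, -1, -1, -2, -2],
            [0, 0, 0, 1, 1, 4, -1, 2],
            [0, 0, 0, 0, 2, 1, 0, 0],
            [0, 0, 0, 0, 0, 1, 1, 2],
            [0, 0, 0, 0, 0, 0, -3, 2],
            [0, 0, 0, 0, 0, 0, 0, -4]] :: int list list"
  have M: "map (\<lambda>i. map (\<lambda>j. table_mat ?xs (pw i) (pw j)) [0..<8]) [0..<8] = ?M"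
    by code_simp
  have "lu_check ?L ?M ?U"
    by code_simp
  from sdet_LU[OF M this] show "sdet units9 (table_mat ?xs) = -1 * 4"
    by (simp add: prod_upt8)
  have "map (\<lambda>j. \<Sum>i\<leftarrow>[0..<8]. ?M ! i ! j) [0..<8] = replicate 8 4"
    by code_simp
  from table_mat_col_sum[OF M this] show "\<And>x. x \<in> set units9 \<Longrightarrow> (\<Sum>y\<in>set units9. table_mat ?xs y x) = 4" .
qed simp

lemma realize_table_8:
  "-8 * (8 + 8 * j) * (1 * (8 + 8 * j + 9 * k)) ^ 8 \<in> int_group_dets GA19 ga_mult ga_inv"
proof (rule realize)
  let ?xs = "map (\<lambda>i. ((pw i, (0, 0)), 1)) [0..<8] @ [((pw 3, (2, 0)), 1), ((pw 6, (2, 1)), -1)] :: ((f9 \<times> f9) \<times> int) list"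
  show "fst ` set ?xs \<subseteq> GA19"
    by (auto simp: GA19_eq F9_def)
  have c: "map (table_coeff ?xs) [0..<8] = [1, 1, 1, 2, 1, 1, 0, 1]"
    by code_simp
  show "sdet [0..<8] (circ (table_coeff ?xs)) = -8 * 8"
    unfolding det_circ using map_upt8_eqD[OF c] by simp
  show "(\<Sum>i = 0..<8. table_coeff ?xs i) = 8"
    using map_upt8_eqD[OF c] by (simp add: sum_upt8)
  let ?M = "[[1, 2, 1, 1, 1, 1, 1, 0],
            [1, 1, 1, 1, 2, 1, 0, 1],
            [2, 1, 1, 0, 1, 1, 1, 1],
            [1, 0, 2, 1, 1, 1, 1, 1],
            [0, 0, 0, 0, -1, 0, 0, 0],
            [0, 1, 1, 1, 1, 1, 1, 2],
            [1, 1, 0, 1, 1, 1, 2, 1],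
            [2, 2, 2, 3, 2, 2, 2, 2]] :: int list list"
  let ?L = "[[1, 0, 0, 0, 0, 0, 0, 0],
            [-1, 1, 0, 0, 0, 0, 0, 0],
            [1, -3, 1, 0, 0, 0, 0, 0],
            [2, -5, 1, 1, 0, 0, 0, 0],
            [0, 0, 0, 0, 1, 0, 0, 0],
            [-2, 1, 1, -1, 2, 2, 0, 0],
            [1, -3, 0, 1, -3, 0, 1, 0],
            [-1, -1, 1, -1, -1, 1, -1, 1]] :: int list list"
  let ?U = "[[1, 2, 1, 1, 1, 1, 1, 0],
            [0, -1, 0, 0, 1, 0, -1, 1],
            [0, 0, -1, -2, -4, -1, 2, -2],
            [0, 0, 0, -2, -6, -1, 4, -3],
            [0, 0, 0, 0, -1, 0, 0, 0],
            [0, 0, 0, 0, 0, 1, 0, 5],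
            [0, 0, 0, 0, 0, 0, 4, -1],
            [0, 0, 0, 0, 0, 0, 0, 2]] :: int list list"
  have M: "map (\<lambda>i. map (\<lambda>j. table_mat ?xs (pw i) (pw j)) [0..<8]) [0..<8] = ?M"
    by code_simp
  have "lu_check ?L ?M ?U"
    by code_simp
  from sdet_LU[OF M this] show "sdet units9 (table_mat ?xs) = 1 * 8"
    by (simp add: prod_upt8)
  have "map (\<lambda>j. \<Sum>i\<leftarrow>[0..<8]. ?M ! i ! j) [0..<8] = replicate 8 8"
    by code_simp
  from table_mat_col_sum[OF M this] show "\<And>x. x \<in> set units9 \<Longrightarrow> (\<Sum>y\<in>set units9. table_mat ?xs y x) = 8" .
qed simp

text \<open>The residue of \<open>A\<close> modulo 8 selects the base element.\<close>

lemma realize_odd: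
  fixes A B :: int
  assumes "odd A" "[B = A] (mod 9)"
  shows "A * B ^ 8 \<in> int_group_dets GA19 ga_mult ga_inv"
proof -
  obtain k where B: "B = A + 9 * k"
    using assms(2) by (metis cong_iff_lin cong_sym)
  define j where "j = A div 8"
  have "A = A mod 8 + 8 * j"
    by (simp add: j_def)
  moreover have "A mod 8 = 1 \<or> A mod 8 = 3 \<or> A mod 8 = 5 \<or> A mod 8 = 7"
    using assms(1) by presburger
  ultimately consider "A = 1 + 8 * j" | "A = 3 + 8 * j" | "A = 5 + 8 * j" | "A = 7 + 8 * j"
    by metis
  then show ?thesis
    using realize_table_1[of j k] realize_table_3[of j k] realize_table_5[of j k] realize_table_7[of j k]
    by cases (simp_all add: B)
qed

text \<open>The base with \<open>P = 8\<close>, \<open>e = 4\<close> reaches the odd multiples of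
  32, the one with \<open>P = -8\<close>, \<open>e = 8\<close> the multiples of 64. In both cases
  \<open>B\<close> starts from \<open>-4 m\<close>, and \<open>32 m = -4 m + 9 (4 m)\<close>
  explains the shift by \<open>4 m\<close> in \<open>k\<close>.\<close>

lemma realize_even:
  fixes A B :: int
  assumes "32 dvd A" "[B = A] (mod 9)"
  shows "A * B ^ 8 \<in> int_group_dets GA19 ga_mult ga_inv"
proof -
  obtain m where A: "A = 32 * m"
    using assms(1) by (rule dvdE)
  obtain k where B: "B = 32 * m + 9 * k"
    using assms(2) unfolding A by (metis cong_iff_lin cong_sym)
  show ?thesis
  proof (cases "even m")
    case True
    then obtain n where n: "m = 2 * n" by (rule evenE)
    have eqs: "-8 * (8 + 8 * (- n - 1)) = A" "8 + 8 * (- n - 1) + 9 * (4 * m + k) = B"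
      by (simp_all add: n A B)
    show ?thesis
      using realize_table_8[of "- n - 1" "4 * m + k"] unfolding eqs mult_1_left .
  next
    case False
    then obtain n where n: "m = 2 * n + 1" by (rule oddE)
    have eqs: "8 * (4 + 8 * n) = A" "- 1 * (4 + 8 * n + 9 * (- (4 * m) - k)) = B"
      by (simp_all add: n A B)
    show ?thesis
      using realize_table_4[of n "- (4 * m) - k"] unfolding eqs .
  qed
qed

theorem theorem5:
  shows "int_group_dets GA19 ga_mult ga_inv =
         {A * B ^ 8 | A B :: int. (odd A \<or> 2 ^ 5 dvd A) \<and> [B = A] (mod 9)}"
proof (intro equalityI subsetI)
  fix D assume "D \<in> int_group_dets GA19 ga_mult ga_inv"
  then obtain a where "D = group_det GA19 ga_mult ga_inv a"
    by (auto simp: int_group_dets_def)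
  then have "D = sdet [0..<8] (circ (quot_coeff a)) * sdet units9 (rho_mat a) ^ 8"
    by (simp add: group_det_GA19)
  moreover have "odd (sdet [0..<8] (circ (quot_coeff a))) \<or> 2 ^ 5 dvd sdet [0..<8] (circ (quot_coeff a))"
    using det_circ_even[of "quot_coeff a"] by auto
  ultimately show "D \<in> {A * B ^ 8 | A B :: int. (odd A \<or> 2 ^ 5 dvd A) \<and> [B = A] (mod 9)}"
    using det_rho_mat_cong[of a] by blast
next
  fix D assume "D \<in> {A * B ^ 8 | A B :: int. (odd A \<or> 2 ^ 5 dvd A) \<and> [B = A] (mod 9)}"
  then show "D \<in> int_group_dets GA19 ga_mult ga_inv"
    using realize_odd realize_even by auto
qed

end
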